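(* Let $n\ge2$, let $\eta\in\mathbb{C}$, and let $\theta_0,\dots,\theta_{n-1}$ be a basis of $\Theta_n(\Gamma)$. In the algebra $\mathcal{V}_n$, let $D_0=\det\big(\theta_{j-1}(z_\alpha)\big)_{1\le\alpha,j\le n}$ and, for $1\le i\le n$, let $D_i$ be the determinant obtained from the matrix $\big(\theta_{j-1}(z_\alpha)\big)_{1\le\alpha,j\le n}$ by deleting its $i$-th column and adjoining the column $(f_1,\dots,f_n)^{T}$ in the last ($n$-th) place. Then the ratios $D_0^{-1}D_i$ form a commutative family: $$[D_0^{-1}D_i,\;D_0^{-1}D_j]=0\qquad (1\le i,j\le n).$$
   Context: Let $\Gamma=\mathbb{Z}\oplus\tau\mathbb{Z}$ with $\operatorname{Im}\tau>0$. $\Theta_n(\Gamma)$ is the $n$-dimensional space of holomorphic functions $f:\mathbb{C}\to\mathbb{C}$ with $f(z+1)=f(z)$, $f(z+\tau)=(-1)^ne^{-2\pi i n z}f(z)$. The Weyl-like algebra $\mathcal{V}_n$ is generated by $f_1,\dots,f_n,z_1,\dots,z_n$ with relations $[f_i,f_j]=[z_i,z_j]=0$, $[f_i,z_j]=0$ for $i\ne j$, and $f_iz_i=(z_i-n\eta)f_i$. It contains meromorphic functions of the $z_i$: as a vector space it is spanned by the elements $F(z_1,\dots,z_n)f_1^{m_1}\cdots f_n^{m_n}$ with $F$ meromorphic in $n$ variables and $m_i\ge 0$, and the commutation rule is $f_jF(z_1,\dots,z_n)=F(z_1,\dots,z_j-n\eta,\dots,z_n)f_j$. The determinants are well defined because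 entries from different rows commute; explicitly, $D_i=\sum_{\alpha=1}^n(-1)^{\alpha+n}M_{\alpha,i}f_\alpha$, where $M_{\alpha,i}$ is the minor of $\big(\theta_{j-1}(z_\alpha)\big)$ with the $\alpha$-th row and $i$-th column omitted. $D_0$ is a nonzero meromorphic function of $z_1,\dots,z_n$, hence invertible in $\mathcal{V}_n$. *)

theory Defs
  imports
    "HOL-Analysis.Analysis"
    "HOL-Algebra.Ring"
    "HOL-Combinatorics.Permutations"
    "HOL-Library.Function_Algebras"
begin

section \<open>Theta functions\<close>

global_interpretation cfun: vector_space "\<lambda>(c::complex) (f::complex \<Rightarrow> complex) z. c * f z"
  by unfold_locales (auto simp: fun_eq_iff algebra_simps)

definition Theta :: "nat \<Rightarrow> complex \<Rightarrow> (complex \<Rightarrow> complex) set" where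
  "Theta n \<tau> = {f. f holomorphic_on UNIV \<and> (\<forall>z. f (z + 1) = f z) \<and>
     (\<forall>z. f (z + \<tau>) = (-1) ^ n * exp (- 2 * of_real pi * \<i> * of_nat n * z) * f z)}"

definition Theta_basis :: "nat \<Rightarrow> complex \<Rightarrow> (nat \<Rightarrow> complex \<Rightarrow> complex) \<Rightarrow> bool" where
  "Theta_basis n \<tau> \<theta> \<longleftrightarrow> inj_on \<theta> {..<n} \<and> cfun.independent (\<theta> ` {..<n}) \<and>
     cfun.span (\<theta> ` {..<n}) = Theta n \<tau>"


section \<open>Meromorphic functions of several variables\<close>

text \<open>Holomorphy: Frechet differentiable with complex-linear derivative.\<close>

definition holomorphic_cn :: "(complex ^ 'n::finite \<Rightarrow> complex) \<Rightarrow> (complex ^ 'n) set \<Rightarrow> bool" where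
  "holomorphic_cn f U \<longleftrightarrow> (\<forall>z\<in>U. \<exists>f'. (f has_derivative f') (at z) \<and>
     (\<forall>c v. f' (c *s v) = c * f' v))"

text \<open>
  A total function represents a meromorphic function if near every point it is a quotient
  \<open>g / h\<close> of holomorphic functions wherever \<open>h\<close> does not vanish, the denominator being
  identically zero on no nonempty open set. Its values where all the local denominators vanish
  are irrelevant; they are removed by passing to classes modulo equality on a dense open set.
\<close>

definition meromorphic_cn :: "(complex ^ 'n::finite \<Rightarrow> complex) \<Rightarrow> bool" where
  "meromorphic_cn F \<longleftrightarrow> (\<forall>p. \<exists>U g h. open U \<and> p \<in> U \<and>
     holomorphic_cn g U \<and> holomorphic_cn h U \<and>
     (\<forall>W. open W \<and> W \<noteq> {} \<and> W \<subseteq> U \<longrightarrow> (\<exists>z\<in>W. h z \<noteq> 0)) \<and>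
     (\<forall>z\<in>U. h z \<noteq> 0 \<longrightarrow> F z = g z / h z))"

definition mero_eq :: "(complex ^ 'n::finite \<Rightarrow> complex) \<Rightarrow> (complex ^ 'n \<Rightarrow> complex) \<Rightarrow> bool" where
  "mero_eq F G \<longleftrightarrow> meromorphic_cn F \<and> meromorphic_cn G \<and>
     (\<exists>S. open S \<and> closure S = UNIV \<and> (\<forall>z\<in>S. F z = G z))"

lemma holomorphic_cn_const: "holomorphic_cn (\<lambda>_. c) U"
  unfolding holomorphic_cn_def by (auto intro!: exI[of _ "\<lambda>_. 0"])

lemma holomorphic_cn_subset: "holomorphic_cn f U \<Longrightarrow> V \<subseteq> U \<Longrightarrow> holomorphic_cn f V"
  unfolding holomorphic_cn_def by blast

lemma holomorphic_cn_add:
  assumes "holomorphic_cn f U" "holomorphic_cn g U"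
  shows "holomorphic_cn (\<lambda>z. f z + g z) U"
  unfolding holomorphic_cn_def
proof
  fix z assume "z \<in> U"
  then obtain f' g' where
    "(f has_derivative f') (at z)" "\<forall>c v. f' (c *s v) = c * f' v"
    "(g has_derivative g') (at z)" "\<forall>c v. g' (c *s v) = c * g' v"
    using assms unfolding holomorphic_cn_def by meson
  then show "\<exists>d. ((\<lambda>z. f z + g z) has_derivative d) (at z) \<and> (\<forall>c v. d (c *s v) = c * d v)"
    by (intro exI[of _ "\<lambda>v. f' v + g' v"]) (auto intro!: has_derivative_add simp: algebra_simps)
qed

lemma holomorphic_cn_mult:
  assumes "holomorphic_cn f U" "holomorphic_cn g U"
  shows "holomorphic_cn (\<lambda>z. f z * g z) U"
  unfolding holomorphic_cn_def
proof
  fix z assume "z \<in> U"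
  then obtain f' g' where
    "(f has_derivative f') (at z)" "\<forall>c v. f' (c *s v) = c * f' v"
    "(g has_derivative g') (at z)" "\<forall>c v. g' (c *s v) = c * g' v"
    using assms unfolding holomorphic_cn_def by meson
  then show "\<exists>d. ((\<lambda>z. f z * g z) has_derivative d) (at z) \<and> (\<forall>c v. d (c *s v) = c * d v)"
    by (intro exI[of _ "\<lambda>v. f z * g' v + f' v * g z"])
       (auto intro!: has_derivative_mult simp: algebra_simps)
qed

lemma holomorphic_cn_continuous_on: "holomorphic_cn f U \<Longrightarrow> continuous_on U f"
  unfolding holomorphic_cn_def
  by (meson continuous_at_imp_continuous_on has_derivative_continuous)

lemma holomorphic_cn_translate:
  assumes "holomorphic_cn f U"
  shows "holomorphic_cn (\<lambda>z. f (z - a)) ((\<lambda>z. z + a) ` U)"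
  unfolding holomorphic_cn_def
proof
  fix z assume "z \<in> (\<lambda>z. z + a) ` U"
  then obtain f' where f': "(f has_derivative f') (at (z - a))" "\<forall>c v. f' (c *s v) = c * f' v"
    using assms unfolding holomorphic_cn_def by force
  have "((\<lambda>z. z - a) has_derivative (\<lambda>v. v)) (at z)"
    by (auto intro!: derivative_eq_intros)
  from has_derivative_compose[OF this f'(1)] f'(2)
  show "\<exists>d. ((\<lambda>z. f (z - a)) has_derivative d) (at z) \<and> (\<forall>c v. d (c *s v) = c * d v)"
    by blast
qed

lemma no_zero_open_mult:
  fixes h k :: "complex ^ 'n::finite \<Rightarrow> complex"
  assumes "holomorphic_cn h U"
    and "\<forall>W. open W \<and> W \<noteq> {} \<and> W \<subseteq> U \<longrightarrow> (\<exists>z\<in>W. h z \<noteq> 0)"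
    and "\<forall>W. open W \<and> W \<noteq> {} \<and> W \<subseteq> V \<longrightarrow> (\<exists>z\<in>W. k z \<noteq> 0)"
    and "open W" "W \<noteq> {}" "W \<subseteq> U \<inter> V"
  shows "\<exists>z\<in>W. h z * k z \<noteq> 0"
proof -
  have "continuous_on W h"
    using holomorphic_cn_continuous_on[OF assms(1)] assms(6) continuous_on_subset by blast
  then have "open (W \<inter> h -` (- {0}))"
    using continuous_on_open_vimage[OF assms(4)] open_Compl[OF closed_singleton, of "0::complex"]
    by (metis Int_commute)
  moreover have "W \<inter> h -` (- {0}) \<noteq> {}"
    using assms(2,4,5,6) by fastforce
  ultimately obtain z where "z \<in> W \<inter> h -` (- {0})" "k z \<noteq> 0"
    using assms(3,6) by (meson Int_subset_iff inf.coboundedI1 le_inf_iff)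
  then show ?thesis by auto
qed

lemma meromorphic_cn_holomorphic: "holomorphic_cn f UNIV \<Longrightarrow> meromorphic_cn f"
  unfolding meromorphic_cn_def
  by (rule allI, rule exI[of _ UNIV], rule exI[of _ f], rule exI[of _ "\<lambda>_. 1"])
     (auto simp: holomorphic_cn_const)

lemma meromorphic_cnE:
  assumes "meromorphic_cn F"
  obtains U g h where "open U" "p \<in> U" "holomorphic_cn g U" "holomorphic_cn h U"
    "\<forall>W. open W \<and> W \<noteq> {} \<and> W \<subseteq> U \<longrightarrow> (\<exists>z\<in>W. h z \<noteq> 0)"
    "\<forall>z\<in>U. h z \<noteq> 0 \<longrightarrow> F z = g z / h z"
  using assms unfolding meromorphic_cn_def
  by (elim allE[where x = p] exE conjE) (rule that)

lemma meromorphic_cn_combine: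
  fixes F G :: "complex ^ 'n::finite \<Rightarrow> complex"
  assumes "meromorphic_cn F" "meromorphic_cn G"
    and hol: "\<And>(U :: (complex ^ 'n) set) g h g' h'. holomorphic_cn g U \<Longrightarrow> holomorphic_cn h U \<Longrightarrow>
      holomorphic_cn g' U \<Longrightarrow> holomorphic_cn h' U \<Longrightarrow>
      holomorphic_cn (\<lambda>z. num (g z) (h z) (g' z) (h' z)) U"
    and op: "\<And>a b c d. b \<noteq> 0 \<Longrightarrow> d \<noteq> 0 \<Longrightarrow> op (a / b) (c / d) = num a b c d / (b * d)"
  shows "meromorphic_cn (\<lambda>z. op (F z) (G z))"
  unfolding meromorphic_cn_def
proof
  fix p
  obtain U g h where 1: "open U" "p \<in> U" "holomorphic_cn g U" "holomorphic_cn h U"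
     "\<forall>W. open W \<and> W \<noteq> {} \<and> W \<subseteq> U \<longrightarrow> (\<exists>z\<in>W. h z \<noteq> 0)"
     "\<forall>z\<in>U. h z \<noteq> 0 \<longrightarrow> F z = g z / h z"
    by (rule meromorphic_cnE[OF assms(1), of p])
  obtain V g' h' where 2: "open V" "p \<in> V" "holomorphic_cn g' V" "holomorphic_cn h' V"
     "\<forall>W. open W \<and> W \<noteq> {} \<and> W \<subseteq> V \<longrightarrow> (\<exists>z\<in>W. h' z \<noteq> 0)"
     "\<forall>z\<in>V. h' z \<noteq> 0 \<longrightarrow> G z = g' z / h' z"
    by (rule meromorphic_cnE[OF assms(2), of p])
  note sub = holomorphic_cn_subset[OF 1(3), of "U \<inter> V"] holomorphic_cn_subset[OF 1(4), of "U \<inter> V"]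
    holomorphic_cn_subset[OF 2(3), of "U \<inter> V"] holomorphic_cn_subset[OF 2(4), of "U \<inter> V"]
  show "\<exists>U g h. open U \<and> p \<in> U \<and> holomorphic_cn g U \<and> holomorphic_cn h U \<and>
     (\<forall>W. open W \<and> W \<noteq> {} \<and> W \<subseteq> U \<longrightarrow> (\<exists>z\<in>W. h z \<noteq> 0)) \<and>
     (\<forall>z\<in>U. h z \<noteq> 0 \<longrightarrow> op (F z) (G z) = g z / h z)"
  proof (intro exI conjI)
    show "open (U \<inter> V)" "p \<in> U \<inter> V" using 1 2 by auto
    show "holomorphic_cn (\<lambda>z. num (g z) (h z) (g' z) (h' z)) (U \<inter> V)"
      using sub by (intro hol[of g "U \<inter> V" h g' h']) auto
    show "holomorphic_cn (\<lambda>z. h z * h' z) (U \<inter> V)"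
      using sub by (intro holomorphic_cn_mult[of h "U \<inter> V" h']) auto
    show "\<forall>W. open W \<and> W \<noteq> {} \<and> W \<subseteq> U \<inter> V \<longrightarrow> (\<exists>z\<in>W. h z * h' z \<noteq> 0)"
      using no_zero_open_mult[OF 1(4,5) 2(5)] by blast
    show "\<forall>z\<in>U \<inter> V. h z * h' z \<noteq> 0 \<longrightarrow>
        op (F z) (G z) = num (g z) (h z) (g' z) (h' z) / (h z * h' z)"
      using 1(6) 2(6) op by simp
  qed
qed

lemma meromorphic_cn_add:
  assumes "meromorphic_cn F" "meromorphic_cn G"
  shows "meromorphic_cn (\<lambda>z. F z + G z)"
proof (rule meromorphic_cn_combine[OF assms, where num = "\<lambda>a b c d. a * d + c * b" and op = "(+)"])
  fix U g h g' h'
  assume "holomorphic_cn g U" "holomorphic_cn h U" "holomorphic_cn g' U" "holomorphic_cn h' U"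
  then show "holomorphic_cn (\<lambda>z. g z * h' z + g' z * h z) U"
    using holomorphic_cn_add[OF holomorphic_cn_mult[of g U h'] holomorphic_cn_mult[of g' U h]]
    by simp
qed (simp add: add_frac_eq)

lemma meromorphic_cn_mult:
  assumes "meromorphic_cn F" "meromorphic_cn G"
  shows "meromorphic_cn (\<lambda>z. F z * G z)"
proof (rule meromorphic_cn_combine[OF assms, where num = "\<lambda>a b c d. a * c" and op = "(*)"])
  fix U g h g' h'
  assume "holomorphic_cn g U" "holomorphic_cn g' U"
  then show "holomorphic_cn (\<lambda>z. g z * g' z) U"
    by (rule holomorphic_cn_mult)
qed simp

lemma meromorphic_cn_const: "meromorphic_cn (\<lambda>_. c)"
  by (intro meromorphic_cn_holomorphic holomorphic_cn_const)

lemma meromorphic_cn_uminus: "meromorphic_cn F \<Longrightarrow> meromorphic_cn (\<lambda>z. - F z)"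
  using meromorphic_cn_mult[OF meromorphic_cn_const[of "-1"]] by simp

lemma meromorphic_cn_translate:
  assumes "meromorphic_cn F"
  shows "meromorphic_cn (\<lambda>z. F (z - a))"
  unfolding meromorphic_cn_def
proof
  fix p
  obtain U g h where 1: "open U" "p - a \<in> U" "holomorphic_cn g U" "holomorphic_cn h U"
     "\<forall>W. open W \<and> W \<noteq> {} \<and> W \<subseteq> U \<longrightarrow> (\<exists>z\<in>W. h z \<noteq> 0)"
     "\<forall>z\<in>U. h z \<noteq> 0 \<longrightarrow> F z = g z / h z"
    by (rule meromorphic_cnE[OF assms, of "p - a"])
  let ?U = "(\<lambda>z. z + a) ` U"
  show "\<exists>U g h. open U \<and> p \<in> U \<and> holomorphic_cn g U \<and> holomorphic_cn h U \<and>
     (\<forall>W. open W \<and> W \<noteq> {} \<and> W \<subseteq> U \<longrightarrow> (\<exists>z\<in>W. h z \<noteq> 0)) \<and>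
     (\<forall>z\<in>U. h z \<noteq> 0 \<longrightarrow> F (z - a) = g z / h z)"
  proof (intro exI conjI)
    show "open ?U" using open_translation[OF 1(1), of a] by (simp add: add.commute)
    show "p \<in> ?U" using 1(2) by force
    show "holomorphic_cn (\<lambda>z. g (z - a)) ?U" "holomorphic_cn (\<lambda>z. h (z - a)) ?U"
      using 1(3,4) by (auto intro: holomorphic_cn_translate)
    show "\<forall>W. open W \<and> W \<noteq> {} \<and> W \<subseteq> ?U \<longrightarrow> (\<exists>z\<in>W. h (z - a) \<noteq> 0)"
    proof (intro allI impI)
      fix W assume W: "open W \<and> W \<noteq> {} \<and> W \<subseteq> ?U"
      then have "open ((\<lambda>z. z - a) ` W)" using open_translation[of W "- a"] by simp
      moreover have "(\<lambda>z. z - a) ` W \<subseteq> U" "(\<lambda>z. z - a) ` W \<noteq> {}" using W by auto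
      ultimately have "\<exists>z\<in>(\<lambda>z. z - a) ` W. h z \<noteq> 0" using 1(5) by presburger
      then show "\<exists>z\<in>W. h (z - a) \<noteq> 0" by auto
    qed
    show "\<forall>z\<in>?U. h (z - a) \<noteq> 0 \<longrightarrow> F (z - a) = g (z - a) / h (z - a)"
      using 1(6) by auto
  qed
qed

lemma open_dense_Int:
  fixes S T :: "'a::topological_space set"
  assumes "open S" "closure S = UNIV" "open T" "closure T = UNIV"
  shows "open (S \<inter> T)" "closure (S \<inter> T) = UNIV"
  using assms open_Int_closure_subset[of S T] closure_minimal[of S "closure (S \<inter> T)"] by auto

lemma mero_eqI:
  "meromorphic_cn F \<Longrightarrow> meromorphic_cn G \<Longrightarrow> open S \<Longrightarrow> closure S = UNIV \<Longrightarrow>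
    (\<And>z. z \<in> S \<Longrightarrow> F z = G z) \<Longrightarrow> mero_eq F G"
  unfolding mero_eq_def by blast

lemma mero_eq_refl: "meromorphic_cn F \<Longrightarrow> mero_eq F F"
  by (rule mero_eqI[of _ _ UNIV]) auto

lemma part_equivp_mero_eq: "part_equivp (mero_eq :: (complex ^ 'n::finite \<Rightarrow> complex) \<Rightarrow> _)"
proof (rule part_equivpI)
  show "\<exists>F :: complex ^ 'n \<Rightarrow> complex. mero_eq F F"
    using mero_eq_refl meromorphic_cn_const by blast
  show "symp (mero_eq :: (complex ^ 'n \<Rightarrow> complex) \<Rightarrow> _)"
    unfolding symp_def mero_eq_def by metis
  show "transp (mero_eq :: (complex ^ 'n \<Rightarrow> complex) \<Rightarrow> _)"
  proof (rule transpI)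
    fix F G H :: "complex ^ 'n \<Rightarrow> complex"
    assume "mero_eq F G" "mero_eq G H"
    then obtain S T where "open S" "closure S = UNIV" "\<forall>z\<in>S. F z = G z"
      "open T" "closure T = UNIV" "\<forall>z\<in>T. G z = H z" "meromorphic_cn F" "meromorphic_cn H"
      unfolding mero_eq_def by blast
    then show "mero_eq F H"
      using open_dense_Int[of S T] by (intro mero_eqI[of _ _ "S \<inter> T"]) auto
  qed
qed

quotient_type 'n mero = "complex ^ 'n::finite \<Rightarrow> complex" / partial: mero_eq
  by (rule part_equivp_mero_eq)

instantiation mero :: (finite) comm_ring_1
begin

lift_definition zero_mero :: "'a mero" is "\<lambda>_. 0"
  by (intro mero_eq_refl meromorphic_cn_const)

lift_definition one_mero :: "'a mero" is "\<lambda>_. 1"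
  by (intro mero_eq_refl meromorphic_cn_const)

lift_definition uminus_mero :: "'a mero \<Rightarrow> 'a mero" is "\<lambda>F z. - F z"
  unfolding mero_eq_def by (auto intro!: meromorphic_cn_uminus)

lift_definition plus_mero :: "'a mero \<Rightarrow> 'a mero \<Rightarrow> 'a mero" is "\<lambda>F G z. F z + G z"
proof -
  fix F F' G G' :: "complex ^ 'a \<Rightarrow> complex"
  assume "mero_eq F F'" "mero_eq G G'"
  then obtain S T where "open S" "closure S = UNIV" "\<forall>z\<in>S. F z = F' z"
    "open T" "closure T = UNIV" "\<forall>z\<in>T. G z = G' z"
    "meromorphic_cn F" "meromorphic_cn F'" "meromorphic_cn G" "meromorphic_cn G'"
    unfolding mero_eq_def by blast
  then show "mero_eq (\<lambda>z. F z + G z) (\<lambda>z. F' z + G' z)"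
    using open_dense_Int[of S T]
    by (intro mero_eqI[of _ _ "S \<inter> T"] meromorphic_cn_add) auto
qed

definition minus_mero :: "'a mero \<Rightarrow> 'a mero \<Rightarrow> 'a mero" where
  "minus_mero F G = F + (- G)"

lift_definition times_mero :: "'a mero \<Rightarrow> 'a mero \<Rightarrow> 'a mero" is "\<lambda>F G z. F z * G z"
proof -
  fix F F' G G' :: "complex ^ 'a \<Rightarrow> complex"
  assume "mero_eq F F'" "mero_eq G G'"
  then obtain S T where "open S" "closure S = UNIV" "\<forall>z\<in>S. F z = F' z"
    "open T" "closure T = UNIV" "\<forall>z\<in>T. G z = G' z"
    "meromorphic_cn F" "meromorphic_cn F'" "meromorphic_cn G" "meromorphic_cn G'"
    unfolding mero_eq_def by blast
  then show "mero_eq (\<lambda>z. F z * G z) (\<lambda>z. F' z * G' z)"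
    using open_dense_Int[of S T]
    by (intro mero_eqI[of _ _ "S \<inter> T"] meromorphic_cn_mult) auto
qed

instance
proof
  fix a b c :: "'a mero"
  note ms = meromorphic_cn_add meromorphic_cn_mult meromorphic_cn_uminus meromorphic_cn_const
  note closed = mero_eqI[OF _ _ open_UNIV closure_UNIV] ms
  show "a * b * c = a * (b * c)" by transfer (rule closed; auto simp: mero_eq_def intro!: ms)
  show "a * b = b * a" by transfer (rule closed; auto simp: mero_eq_def intro!: ms)
  show "1 * a = a" by transfer (rule closed; auto simp: mero_eq_def intro!: ms)
  show "a + b + c = a + (b + c)" by transfer (rule closed; auto simp: mero_eq_def intro!: ms)
  show "a + b = b + a" by transfer (rule closed; auto simp: mero_eq_def intro!: ms)
  show "0 + a = a" by transfer (rule closed; auto simp: mero_eq_def intro!: ms)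
  show "- a + a = 0" by transfer (rule closed; auto simp: mero_eq_def intro!: ms)
  show "a - b = a + - b" by (rule minus_mero_def)
  show "(a + b) * c = a * c + b * c"
    by transfer (rule closed; auto simp: mero_eq_def algebra_simps intro!: ms)
  show "(0::'a mero) \<noteq> 1" by transfer (auto simp: mero_eq_def)
qed

end

lift_definition shift_mero :: "complex ^ 'n \<Rightarrow> 'n::finite mero \<Rightarrow> 'n mero" is "\<lambda>a F z. F (z - a)"
proof -
  fix a and F G :: "complex ^ 'n \<Rightarrow> complex"
  assume "mero_eq F G"
  then obtain S where S: "open S" "closure S = UNIV" "\<forall>z\<in>S. F z = G z"
    "meromorphic_cn F" "meromorphic_cn G"
    unfolding mero_eq_def by blast
  have "closure ((+) a ` S) = UNIV"
    using S(2) closure_translation[of a S] by (simp add: surj_plus)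
  with S show "mero_eq (\<lambda>z. F (z - a)) (\<lambda>z. G (z - a))"
    by (intro mero_eqI[of _ _ "(+) a ` S"] meromorphic_cn_translate)
       (auto intro: open_translation)
qed

text \<open>The class of a function; unspecified unless the function is meromorphic.\<close>

definition mero_of :: "(complex ^ 'n::finite \<Rightarrow> complex) \<Rightarrow> 'n mero" where
  "mero_of F = abs_mero F"


section \<open>The Weyl-like algebra\<close>

text \<open>
  The dimension is the cardinality of the index type \<open>'n\<close>. An element \<open>x\<close> stands for the finite sum
  of the terms \<open>x m \<cdot> f\<^sup>m\<close> over multi-indices \<open>m\<close>; the product is determined by
  \<open>f\<^sup>m \<cdot> G(z) = G(z - n\<eta>m) \<cdot> f\<^sup>m\<close>.
\<close>

type_synonym 'n weyl = "('n \<Rightarrow> nat) \<Rightarrow> 'n mero"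

definition weyl_shift :: "complex \<Rightarrow> ('n::finite \<Rightarrow> nat) \<Rightarrow> 'n mero \<Rightarrow> 'n mero" where
  "weyl_shift \<eta> m = shift_mero (\<chi> \<alpha>. of_nat CARD('n) * \<eta> * of_nat (m \<alpha>))"

definition weyl_algebra :: "complex \<Rightarrow> ('n::finite weyl) ring" where
  "weyl_algebra \<eta> =
    \<lparr>carrier = {x. finite {m. x m \<noteq> 0}},
     mult = (\<lambda>x y k. \<Sum>m | \<forall>\<alpha>. m \<alpha> \<le> k \<alpha>. x m * weyl_shift \<eta> m (y (\<lambda>\<alpha>. k \<alpha> - m \<alpha>))),
     one = (\<lambda>m. if m = (\<lambda>_. 0) then 1 else 0),
     zero = (\<lambda>m. 0),
     add = (\<lambda>x y m. x m + y m)\<rparr>"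

definition weyl_fun :: "'n::finite mero \<Rightarrow> 'n weyl" where
  "weyl_fun F = (\<lambda>m. if m = (\<lambda>_. 0) then F else 0)"

definition weyl_gen :: "'n::finite \<Rightarrow> 'n weyl" where
  "weyl_gen \<alpha> = (\<lambda>m. if m = (\<lambda>\<beta>. if \<beta> = \<alpha> then 1 else 0) then 1 else 0)"

lemma finite_le_multiindex: "finite {m :: 'n::finite \<Rightarrow> nat. \<forall>\<alpha>. m \<alpha> \<le> k \<alpha>}"
proof -
  have "{m. \<forall>\<alpha>. m \<alpha> \<le> k \<alpha>} = PiE UNIV (\<lambda>\<alpha>. {..k \<alpha>})"
    by (auto simp: PiE_def)
  then show ?thesis by (simp add: finite_PiE)
qed

lemma weyl_shift_hom:
  "weyl_shift \<eta> m (F + G) = weyl_shift \<eta> m F + weyl_shift \<eta> m G"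
  "weyl_shift \<eta> m (F * G) = weyl_shift \<eta> m F * weyl_shift \<eta> m G"
  "weyl_shift \<eta> m 0 = 0" "weyl_shift \<eta> m 1 = 1"
  unfolding weyl_shift_def
  by (transfer, auto simp: mero_eq_def intro!: meromorphic_cn_add meromorphic_cn_mult
      meromorphic_cn_translate meromorphic_cn_const exI[of _ UNIV])+

lemma weyl_shift_sum: "weyl_shift \<eta> m (sum F A) = (\<Sum>a\<in>A. weyl_shift \<eta> m (F a))"
  by (induction A rule: infinite_finite_induct) (auto simp: weyl_shift_hom)

lemma shift_mero_shift_mero: "shift_mero a (shift_mero b F) = shift_mero (a + b) F"
proof transfer
  fix a b and F :: "complex ^ 'n \<Rightarrow> complex"
  assume "mero_eq F F"
  then show "mero_eq (\<lambda>z. F (z - a - b)) (\<lambda>z. F (z - (a + b)))"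
    by (auto simp: mero_eq_def diff_diff_eq intro!: meromorphic_cn_translate)
qed

lemma shift_mero_0: "shift_mero 0 F = F"
  by transfer simp

lemma weyl_shift_weyl_shift:
  "weyl_shift \<eta> m (weyl_shift \<eta> k F) = weyl_shift \<eta> (\<lambda>\<alpha>. m \<alpha> + k \<alpha>) F"
proof -
  have "(\<chi> \<alpha>. of_nat CARD('a) * \<eta> * of_nat (m \<alpha>)) + (\<chi> \<alpha>. of_nat CARD('a) * \<eta> * of_nat (k \<alpha>)) =
    (\<chi> \<alpha>. of_nat CARD('a) * \<eta> * of_nat (m \<alpha> + k \<alpha>))"
    by (simp add: vec_eq_iff algebra_simps)
  then show ?thesis unfolding weyl_shift_def by (simp add: shift_mero_shift_mero)
qed

lemma weyl_shift_0: "weyl_shift \<eta> (\<lambda>_. 0) F = F"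
proof -
  have "(\<chi> \<alpha>. of_nat CARD('a) * \<eta> * of_nat 0) = (0 :: complex ^ 'a)"
    by (simp add: vec_eq_iff)
  then show ?thesis unfolding weyl_shift_def by (simp add: shift_mero_0)
qed


lemma weyl_mult_closed:
  assumes "x \<in> carrier (weyl_algebra \<eta>)" "y \<in> carrier (weyl_algebra \<eta>)"
  shows "x \<otimes>\<^bsub>weyl_algebra \<eta>\<^esub> y \<in> carrier (weyl_algebra \<eta>)"
proof -
  let ?S = "(\<lambda>(m, l) \<alpha>. m \<alpha> + l \<alpha>) ` ({m. x m \<noteq> 0} \<times> {m. y m \<noteq> 0})"
  have "k \<in> ?S" if k: "(x \<otimes>\<^bsub>weyl_algebra \<eta>\<^esub> y) k \<noteq> 0" for k
  proof -
    from k obtain m where m: "\<forall>\<alpha>. m \<alpha> \<le> k \<alpha>" "x m * weyl_shift \<eta> m (y (\<lambda>\<alpha>. k \<alpha> - m \<alpha>)) \<noteq> 0"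
      unfolding weyl_algebra_def by (auto elim: sum.not_neutral_contains_not_neutral)
    then have "x m \<noteq> 0" "y (\<lambda>\<alpha>. k \<alpha> - m \<alpha>) \<noteq> 0"
      by (auto simp: weyl_shift_hom)
    moreover have "k = (\<lambda>(m, l) \<alpha>. m \<alpha> + l \<alpha>) (m, \<lambda>\<alpha>. k \<alpha> - m \<alpha>)"
      using m(1) by simp
    ultimately show ?thesis
      by (metis (mono_tags, lifting) image_eqI mem_Collect_eq mem_Sigma_iff)
  qed
  then have "{k. (x \<otimes>\<^bsub>weyl_algebra \<eta>\<^esub> y) k \<noteq> 0} \<subseteq> ?S" by blast
  moreover have "finite ?S" using assms by (auto simp: weyl_algebra_def)
  ultimately have "finite {k. (x \<otimes>\<^bsub>weyl_algebra \<eta>\<^esub> y) k \<noteq> 0}"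
    by (rule finite_subset)
  then show ?thesis by (simp add: weyl_algebra_def)
qed

lemma weyl_mult_assoc:
  "(x \<otimes>\<^bsub>weyl_algebra \<eta>\<^esub> y) \<otimes>\<^bsub>weyl_algebra \<eta>\<^esub> z =
    x \<otimes>\<^bsub>weyl_algebra \<eta>\<^esub> (y \<otimes>\<^bsub>weyl_algebra \<eta>\<^esub> z)"
proof
  fix k :: "'a \<Rightarrow> nat"
  let ?B = "\<lambda>k :: 'a \<Rightarrow> nat. {m. \<forall>\<alpha>. m \<alpha> \<le> k \<alpha>}"
  let ?sh = "weyl_shift \<eta>"
  have "((x \<otimes>\<^bsub>weyl_algebra \<eta>\<^esub> y) \<otimes>\<^bsub>weyl_algebra \<eta>\<^esub> z) k =
    (\<Sum>m\<in>?B k. \<Sum>a\<in>?B m. x a * ?sh a (y (\<lambda>\<alpha>. m \<alpha> - a \<alpha>)) * ?sh m (z (\<lambda>\<alpha>. k \<alpha> - m \<alpha>)))"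
    by (simp add: weyl_algebra_def sum_distrib_right)
  also have "\<dots> = (\<Sum>(m, a)\<in>Sigma (?B k) ?B.
      x a * ?sh a (y (\<lambda>\<alpha>. m \<alpha> - a \<alpha>)) * ?sh m (z (\<lambda>\<alpha>. k \<alpha> - m \<alpha>)))"
    by (rule sum.Sigma) (auto simp: finite_le_multiindex)
  also have "\<dots> = (\<Sum>(a, b)\<in>Sigma (?B k) (\<lambda>a. ?B (\<lambda>\<alpha>. k \<alpha> - a \<alpha>)).
      x a * ?sh a (y b) * ?sh (\<lambda>\<alpha>. a \<alpha> + b \<alpha>) (z (\<lambda>\<alpha>. k \<alpha> - (a \<alpha> + b \<alpha>))))"
  proof (rule sum.reindex_bij_witness[where
        i = "\<lambda>(a, b). (\<lambda>\<alpha>. a \<alpha> + b \<alpha>, a)" and j = "\<lambda>(m, a). (a, \<lambda>\<alpha>. m \<alpha> - a \<alpha>)"],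
      goal_cases)
    case (1 p) then show ?case by (auto simp: fun_eq_iff)
  next
    case (2 p) then show ?case by (auto intro: le_trans diff_le_mono)
  next
    case (3 p) then show ?case by (auto simp: fun_eq_iff)
  next
    case (4 p) then show ?case by (auto simp: le_diff_conv2 add.commute le_diff_conv)
  next
    case (5 p) then show ?case by auto
  qed
  also have "\<dots> = (\<Sum>a\<in>?B k. \<Sum>b\<in>?B (\<lambda>\<alpha>. k \<alpha> - a \<alpha>).
      x a * ?sh a (y b) * ?sh (\<lambda>\<alpha>. a \<alpha> + b \<alpha>) (z (\<lambda>\<alpha>. k \<alpha> - (a \<alpha> + b \<alpha>))))"
    by (rule sum.Sigma[symmetric]) (auto simp: finite_le_multiindex)
  also have "\<dots> = (x \<otimes>\<^bsub>weyl_algebra \<eta>\<^esub> (y \<otimes>\<^bsub>weyl_algebra \<eta>\<^esub> z)) k"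
    by (simp add: weyl_algebra_def sum_distrib_left weyl_shift_sum weyl_shift_hom
        weyl_shift_weyl_shift mult.assoc diff_diff_eq)
  finally show "((x \<otimes>\<^bsub>weyl_algebra \<eta>\<^esub> y) \<otimes>\<^bsub>weyl_algebra \<eta>\<^esub> z) k =
    (x \<otimes>\<^bsub>weyl_algebra \<eta>\<^esub> (y \<otimes>\<^bsub>weyl_algebra \<eta>\<^esub> z)) k" .
qed

lemma ring_weyl_algebra: "ring (weyl_algebra \<eta>)"
proof (rule ringI)
  have fin: "finite {m. x m + y m \<noteq> 0}" if "finite {m. x m \<noteq> 0}" "finite {m. y m \<noteq> 0}"
    for x y :: "'a weyl"
    by (rule finite_subset[OF _ finite_UnI[OF that]]) auto
  show "abelian_group (weyl_algebra \<eta> :: 'a weyl ring)"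
  proof (rule abelian_groupI)
    fix x :: "'a weyl" assume "x \<in> carrier (weyl_algebra \<eta>)"
    then show "\<exists>y\<in>carrier (weyl_algebra \<eta>). y \<oplus>\<^bsub>weyl_algebra \<eta>\<^esub> x = \<zero>\<^bsub>weyl_algebra \<eta>\<^esub>"
      by (intro bexI[of _ "\<lambda>m. - x m"]) (auto simp: weyl_algebra_def)
  qed (auto simp: weyl_algebra_def add_ac intro: fin)
  show "monoid (weyl_algebra \<eta> :: 'a weyl ring)"
  proof (rule monoidI)
    show "\<one>\<^bsub>weyl_algebra \<eta>\<^esub> \<in> carrier (weyl_algebra \<eta> :: 'a weyl ring)"
      by (simp add: weyl_algebra_def)
    fix x :: "'a weyl"
    have *: "{m. \<forall>\<alpha>. m \<alpha> \<le> k \<alpha>} = insert (\<lambda>_. 0) ({m. \<forall>\<alpha>. m \<alpha> \<le> k \<alpha>} - {\<lambda>_. 0})"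
      "{m. \<forall>\<alpha>. m \<alpha> \<le> k \<alpha>} = insert k ({m. \<forall>\<alpha>. m \<alpha> \<le> k \<alpha>} - {k})" for k :: "'a \<Rightarrow> nat"
      by auto
    show "\<one>\<^bsub>weyl_algebra \<eta>\<^esub> \<otimes>\<^bsub>weyl_algebra \<eta>\<^esub> x = x"
    proof
      fix k
      have "(\<Sum>m | \<forall>\<alpha>. m \<alpha> \<le> k \<alpha>. (if m = (\<lambda>_. 0) then 1 else 0) *
          weyl_shift \<eta> m (x (\<lambda>\<alpha>. k \<alpha> - m \<alpha>))) =
        (\<Sum>m | \<forall>\<alpha>. m \<alpha> \<le> k \<alpha>. if m = (\<lambda>_. 0) then x k else 0)"
        by (rule sum.cong) (auto simp: weyl_shift_0)
      then show "(\<one>\<^bsub>weyl_algebra \<eta>\<^esub> \<otimes>\<^bsub>weyl_algebra \<eta>\<^esub> x) k = x k"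
        by (simp add: weyl_algebra_def finite_le_multiindex)
    qed
    show "x \<otimes>\<^bsub>weyl_algebra \<eta>\<^esub> \<one>\<^bsub>weyl_algebra \<eta>\<^esub> = x"
    proof
      fix k
      have "(\<Sum>m | \<forall>\<alpha>. m \<alpha> \<le> k \<alpha>. x m *
          weyl_shift \<eta> m (if (\<lambda>\<alpha>. k \<alpha> - m \<alpha>) = (\<lambda>_. 0) then 1 else 0)) =
        (\<Sum>m | \<forall>\<alpha>. m \<alpha> \<le> k \<alpha>. if m = k then x k else 0)"
      proof (rule sum.cong[OF refl])
        fix m assume "m \<in> {m. \<forall>\<alpha>. m \<alpha> \<le> k \<alpha>}"
        then have "(\<lambda>\<alpha>. k \<alpha> - m \<alpha>) = (\<lambda>_. 0) \<longleftrightarrow> m = k"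
          by (auto simp: fun_eq_iff intro: le_antisym)
        then show "x m * weyl_shift \<eta> m (if (\<lambda>\<alpha>. k \<alpha> - m \<alpha>) = (\<lambda>_. 0) then 1 else 0) =
            (if m = k then x k else 0)"
          by (cases "m = k") (simp_all only: weyl_shift_hom if_True if_False simp_thms mult_1_right mult_zero_right)
      qed
      then show "(x \<otimes>\<^bsub>weyl_algebra \<eta>\<^esub> \<one>\<^bsub>weyl_algebra \<eta>\<^esub>) k = x k"
        by (simp add: weyl_algebra_def finite_le_multiindex)
    qed
  qed (simp_all add: weyl_mult_closed weyl_mult_assoc)
qed (simp_all add: weyl_algebra_def weyl_shift_hom algebra_simps sum.distrib)

lemma weyl_gen_weyl_fun:
  "weyl_gen \<beta> \<otimes>\<^bsub>weyl_algebra \<eta>\<^esub> weyl_fun (F :: 'n::finite mero) =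
    weyl_fun (shift_mero (\<chi> \<alpha>. if \<alpha> = \<beta> then of_nat CARD('n) * \<eta> else 0) F)
      \<otimes>\<^bsub>weyl_algebra \<eta>\<^esub> weyl_gen \<beta>"
proof
  fix k :: "'n \<Rightarrow> nat"
  let ?e = "\<lambda>\<alpha>. if \<alpha> = \<beta> then 1 else 0 :: nat"
  let ?G = "shift_mero (\<chi> \<alpha>. if \<alpha> = \<beta> then of_nat CARD('n) * \<eta> else 0) F"
  have sh: "weyl_shift \<eta> ?e F = ?G"
    unfolding weyl_shift_def by (rule arg_cong[where f = "\<lambda>a. shift_mero a F"]) (simp add: vec_eq_iff)
  have "(weyl_gen \<beta> \<otimes>\<^bsub>weyl_algebra \<eta>\<^esub> weyl_fun F) k =
    (\<Sum>m | \<forall>\<alpha>. m \<alpha> \<le> k \<alpha>. if m = ?e then (if k = ?e then ?G else 0) else 0)"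
    unfolding weyl_algebra_def weyl_gen_def weyl_fun_def ring.simps monoid.simps
  proof (rule sum.cong[OF refl])
    fix m assume "m \<in> {m. \<forall>\<alpha>. m \<alpha> \<le> k \<alpha>}"
    then have "(\<lambda>\<alpha>. k \<alpha> - m \<alpha>) = (\<lambda>_. 0) \<longleftrightarrow> k = m"
      by (auto simp: fun_eq_iff intro: le_antisym)
    then show "(if m = ?e then 1 else 0) * weyl_shift \<eta> m (if (\<lambda>\<alpha>. k \<alpha> - m \<alpha>) = (\<lambda>_. 0) then F else 0) =
      (if m = ?e then (if k = ?e then ?G else 0) else 0)"
      by (cases "m = ?e"; cases "k = m") (simp_all only: sh weyl_shift_hom if_True if_False simp_thms mult_1 mult_zero_left mult_zero_right)
  qed
  also have "\<dots> = (if k = ?e then ?G else 0)"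
    by (auto simp: finite_le_multiindex)
  also have "\<dots> = (\<Sum>m | \<forall>\<alpha>. m \<alpha> \<le> k \<alpha>. if m = (\<lambda>_. 0) then (if k = ?e then ?G else 0) else 0)"
    by (simp add: finite_le_multiindex)
  also have "\<dots> = (weyl_fun ?G \<otimes>\<^bsub>weyl_algebra \<eta>\<^esub> weyl_gen \<beta>) k"
    unfolding weyl_algebra_def weyl_gen_def weyl_fun_def ring.simps monoid.simps
    by (rule sum.cong) (auto simp: weyl_shift_0 weyl_shift_hom)
  finally show "(weyl_gen \<beta> \<otimes>\<^bsub>weyl_algebra \<eta>\<^esub> weyl_fun F) k =
    (weyl_fun ?G \<otimes>\<^bsub>weyl_algebra \<eta>\<^esub> weyl_gen \<beta>) k" .
qed


section \<open>The determinants\<close>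

text \<open>
  Rows and columns are numbered from \<open>0\<close>, and the factors are multiplied in the order of the rows.
  For the matrices below entries from different rows commute, so this order is immaterial.
\<close>

definition nc_det :: "('a, 'b) ring_scheme \<Rightarrow> nat \<Rightarrow> (nat \<Rightarrow> nat \<Rightarrow> 'a) \<Rightarrow> 'a" where
  "nc_det R n A = (\<Oplus>\<^bsub>R\<^esub>p\<in>{p. p permutes {..<n}}.
     [sign p] \<cdot>\<^bsub>R\<^esub> foldr (\<lambda>x y. x \<otimes>\<^bsub>R\<^esub> y) (map (\<lambda>\<alpha>. A \<alpha> (p \<alpha>)) [0..<n]) \<one>\<^bsub>R\<^esub>)"

text \<open>A fixed numbering of the coordinates by \<open>0, \<dots>, n - 1\<close>; it gives \<open>z\<^sub>\<alpha>\<close> and \<open>f\<^sub>\<alpha>\<close> their indices.\<close>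

definition coord :: "nat \<Rightarrow> 'n::finite" where
  "coord = from_nat_into UNIV"

lemma bij_betw_coord: "bij_betw coord {..<CARD('n)} (UNIV :: 'n::finite set)"
  unfolding coord_def by (rule bij_betw_from_nat_into_finite) simp

definition theta_at :: "(nat \<Rightarrow> complex \<Rightarrow> complex) \<Rightarrow> nat \<Rightarrow> nat \<Rightarrow> 'n::finite weyl" where
  "theta_at \<theta> \<alpha> j = weyl_fun (mero_of (\<lambda>z. \<theta> j (z $ coord \<alpha>)))"

definition D_zero :: "complex \<Rightarrow> (nat \<Rightarrow> complex \<Rightarrow> complex) \<Rightarrow> 'n::finite weyl" where
  "D_zero \<eta> \<theta> = nc_det (weyl_algebra \<eta>) CARD('n) (theta_at \<theta>)"

text \<open>\<open>D_del \<eta> \<theta> i\<close> is meant for \<open>1 \<le> i \<le> n\<close>: the deleted column is the one containing \<open>\<theta>\<^sub>i\<^sub>-\<^sub>1\<close>.\<close>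

definition D_del :: "complex \<Rightarrow> (nat \<Rightarrow> complex \<Rightarrow> complex) \<Rightarrow> nat \<Rightarrow> 'n::finite weyl" where
  "D_del \<eta> \<theta> i = nc_det (weyl_algebra \<eta>) CARD('n) (\<lambda>\<alpha> j.
     if Suc j = CARD('n) then weyl_gen (coord \<alpha>)
     else theta_at \<theta> \<alpha> (if Suc j < i then j else Suc j))"

definition D_ratio :: "complex \<Rightarrow> (nat \<Rightarrow> complex \<Rightarrow> complex) \<Rightarrow> nat \<Rightarrow> 'n::finite weyl" where
  "D_ratio \<eta> \<theta> i = inv\<^bsub>weyl_algebra \<eta>\<^esub> (D_zero \<eta> \<theta>) \<otimes>\<^bsub>weyl_algebra \<eta>\<^esub> D_del \<eta> \<theta> i"

end

theory Submission
  imports Defs "HOL-Complex_Analysis.Conformal_Mappings" "Jordan_Normal_Form.Determinant"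
begin

text \<open>
  Let \<open>B\<close> be the matrix with entries \<open>B\<^sub>\<alpha>\<^sub>i = \<theta>\<^sub>i\<^sub>-\<^sub>1(z\<^sub>\<alpha>)\<close>. By Cramer's rule the ratios
  \<open>H\<^sub>i = D\<^sub>0\<^sup>-\<^sup>1 D\<^sub>i\<close> are, up to sign, the components of \<open>B\<^sup>-\<^sup>1 f\<close>. Absorb the signs into the columns
  of \<open>B\<close>; then the \<open>H\<^sub>i\<close> solve the linear system \<open>\<Sum>\<^sub>i B\<^sub>\<alpha>\<^sub>i H\<^sub>i = f\<^sub>\<alpha>\<close>. What makes them commute is that
  this system is separated: row \<open>\<alpha>\<close> involves only \<open>z\<^sub>\<alpha>\<close>, so \<open>f\<^sub>\<alpha>\<close> commutes with every row other than
  its own. For \<open>\<alpha> \<noteq> \<beta>\<close> this gives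

  \<open>f\<^sub>\<alpha> f\<^sub>\<beta> = \<Sum>\<^sub>j f\<^sub>\<alpha> B\<^sub>\<beta>\<^sub>j H\<^sub>j = \<Sum>\<^sub>j B\<^sub>\<beta>\<^sub>j f\<^sub>\<alpha> H\<^sub>j = \<Sum>\<^sub>i\<^sub>j B\<^sub>\<alpha>\<^sub>i B\<^sub>\<beta>\<^sub>j H\<^sub>i H\<^sub>j\<close>.

  The left-hand side is symmetric in \<open>\<alpha>\<close> and \<open>\<beta>\<close>, hence \<open>\<Sum>\<^sub>i\<^sub>j B\<^sub>\<alpha>\<^sub>i B\<^sub>\<beta>\<^sub>j [H\<^sub>i, H\<^sub>j] = 0\<close>. For
  \<open>\<alpha> = \<beta>\<close> the same identity holds because the entries of \<open>B\<close> commute while the commutator is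
  antisymmetric. Cancelling \<open>B\<close> twice yields \<open>[H\<^sub>i, H\<^sub>j] = 0\<close>. This argument is valid in every ring
  and is the lemma \<open>separated_system_solutions_commute\<close>.

  Two facts about the determinants connect the theorem with this principle. Since \<open>f\<^sub>\<alpha>\<close> commutes with
  the other rows, it can be moved to the right end of each product in the expansion of \<open>D\<^sub>i\<close>, so \<open>D\<^sub>i\<close>
  is a combination of the \<open>f\<^sub>\<alpha>\<close> with ordinary signed minors of \<open>B\<close> as coefficients
  (\<open>nc_det_generator_column\<close>); the adjugate identities then identify \<open>D\<^sub>0\<^sup>-\<^sup>1 D\<^sub>i\<close> with \<open>H\<^sub>i\<close>. And \<open>D\<^sub>0\<close>
  is invertible because the holomorphic function \<open>det (\<theta>\<^sub>j\<^sub>-\<^sub>1(z\<^sub>\<alpha>))\<close> vanishes identically on no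
  nonempty open set (\<open>theta_det_nonzero_on_open\<close>): linearly independent entire functions stay
  independent on every nonempty open subset of the plane, so the points \<open>z\<^sub>1, z\<^sub>2, \<dots>\<close> can be chosen
  one after the other, each keeping a leading minor nonzero.
\<close>

(* Determinants here are those of matrices whose size is a number, not a type. *)
hide_const (open) Determinants.det

section \<open>Separated linear systems over a ring\<close>

lemma (in abelian_monoid) finsum_swap:
  assumes "finite A" "finite B" "\<And>a b. a \<in> A \<Longrightarrow> b \<in> B \<Longrightarrow> f a b \<in> carrier G"
  shows "(\<Oplus>a\<in>A. \<Oplus>b\<in>B. f a b) = (\<Oplus>b\<in>B. \<Oplus>a\<in>A. f a b)"
  using assms
proof (induction A)
  case empty
  then show ?case by (simp add: finsum_zero)
next
  case (insert a A)
  have "(\<Oplus>b\<in>B. \<Oplus>a\<in>insert a A. f a b) = (\<Oplus>b\<in>B. f a b \<oplus> (\<Oplus>a\<in>A. f a b))"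
    using insert by (intro finsum_cong') (auto simp: finsum_insert)
  also have "\<dots> = (\<Oplus>b\<in>B. f a b) \<oplus> (\<Oplus>b\<in>B. \<Oplus>a\<in>A. f a b)"
    using insert by (intro finsum_addf) (auto intro: finsum_closed)
  finally show ?case
    using insert by (simp add: finsum_insert finsum_closed)
qed

context ring
begin

lemma matrix_action_assoc:
  assumes "finite I" "finite J"
    and "\<And>i. i \<in> I \<Longrightarrow> M i \<in> carrier R"
    and "\<And>i j. i \<in> I \<Longrightarrow> j \<in> J \<Longrightarrow> N i j \<in> carrier R"
    and "\<And>j. j \<in> J \<Longrightarrow> x j \<in> carrier R"
  shows "(\<Oplus>i\<in>I. M i \<otimes> (\<Oplus>j\<in>J. N i j \<otimes> x j)) = (\<Oplus>j\<in>J. (\<Oplus>i\<in>I. M i \<otimes> N i j) \<otimes> x j)"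
proof -
  have "(\<Oplus>i\<in>I. M i \<otimes> (\<Oplus>j\<in>J. N i j \<otimes> x j)) = (\<Oplus>i\<in>I. \<Oplus>j\<in>J. M i \<otimes> N i j \<otimes> x j)"
    using assms by (intro finsum_cong') (auto simp: finsum_rdistr m_assoc Pi_def intro!: finsum_cong')
  also have "\<dots> = (\<Oplus>j\<in>J. \<Oplus>i\<in>I. M i \<otimes> N i j \<otimes> x j)"
    using assms by (intro finsum_swap) auto
  also have "\<dots> = (\<Oplus>j\<in>J. (\<Oplus>i\<in>I. M i \<otimes> N i j) \<otimes> x j)"
    using assms by (intro finsum_cong') (auto simp: finsum_ldistr Pi_def)
  finally show ?thesis .
qed

lemma finsum_delta_mult:
  assumes "finite I" "k \<in> I" "\<And>i. i \<in> I \<Longrightarrow> x i \<in> carrier R"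
  shows "(\<Oplus>i\<in>I. (if k = i then \<one> else \<zero>) \<otimes> x i) = x k"
proof -
  have "(\<Oplus>i\<in>I. (if k = i then \<one> else \<zero>) \<otimes> x i) = (\<Oplus>i\<in>I. if k = i then x i else \<zero>)"
    using assms by (intro finsum_cong') auto
  then show ?thesis
    using finsum_singleton[of k I x] assms by auto
qed

text \<open>
  This is how an inverse matrix is used when the unknowns do not commute with the coefficients: a
  system with coefficients on the left is determined by its right-hand sides as soon as the
  coefficient matrix has a left inverse.
\<close>

lemma left_inverse_matrix_cancel:
  assumes fin: "finite I" "finite A"
    and B: "\<And>\<alpha> i. \<alpha> \<in> A \<Longrightarrow> i \<in> I \<Longrightarrow> B \<alpha> i \<in> carrier R"
    and C: "\<And>\<alpha> i. \<alpha> \<in> A \<Longrightarrow> i \<in> I \<Longrightarrow> C i \<alpha> \<in> carrier R"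
    and CB: "\<And>i j. i \<in> I \<Longrightarrow> j \<in> I \<Longrightarrow> (\<Oplus>\<alpha>\<in>A. C i \<alpha> \<otimes> B \<alpha> j) = (if i = j then \<one> else \<zero>)"
    and x: "\<And>i. i \<in> I \<Longrightarrow> x i \<in> carrier R" and y: "\<And>i. i \<in> I \<Longrightarrow> y i \<in> carrier R"
    and eq: "\<And>\<alpha>. \<alpha> \<in> A \<Longrightarrow> (\<Oplus>i\<in>I. B \<alpha> i \<otimes> x i) = (\<Oplus>i\<in>I. B \<alpha> i \<otimes> y i)"
    and k: "k \<in> I"
  shows "x k = y k"
proof -
  have *: "(\<Oplus>\<alpha>\<in>A. C k \<alpha> \<otimes> (\<Oplus>i\<in>I. B \<alpha> i \<otimes> v i)) = v k"
    if v: "\<And>i. i \<in> I \<Longrightarrow> v i \<in> carrier R" for v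
  proof -
    have "(\<Oplus>\<alpha>\<in>A. C k \<alpha> \<otimes> (\<Oplus>i\<in>I. B \<alpha> i \<otimes> v i)) = (\<Oplus>i\<in>I. (\<Oplus>\<alpha>\<in>A. C k \<alpha> \<otimes> B \<alpha> i) \<otimes> v i)"
      using fin B C k v by (intro matrix_action_assoc) auto
    also have "\<dots> = (\<Oplus>i\<in>I. (if k = i then \<one> else \<zero>) \<otimes> v i)"
      using CB k v by (intro finsum_cong') auto
    finally show ?thesis
      using finsum_delta_mult[of I k v] fin k v by simp
  qed
  have "x k = (\<Oplus>\<alpha>\<in>A. C k \<alpha> \<otimes> (\<Oplus>i\<in>I. B \<alpha> i \<otimes> x i))"
    using *[of x] x by simp
  also have "\<dots> = (\<Oplus>\<alpha>\<in>A. C k \<alpha> \<otimes> (\<Oplus>i\<in>I. B \<alpha> i \<otimes> y i))"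
    using eq B C k y by (intro finsum_cong') (auto intro!: finsum_closed m_closed simp: Pi_def)
  finally show ?thesis
    using *[of y] y by simp
qed

text \<open>
  The two-sided inverse is used in two ways: \<open>BC\<close> shows that \<open>H\<close> solves the system \<open>B H = f\<close>, while
  \<open>CB\<close> lets one cancel \<open>B\<close> from the left. The sum \<open>T \<alpha> \<beta>\<close> in the proof is
  \<open>\<Sum>\<^sub>k\<^sub>l B\<^sub>\<beta>\<^sub>l B\<^sub>\<alpha>\<^sub>k H\<^sub>k H\<^sub>l\<close>. Its symmetry in \<open>\<alpha>\<close> and \<open>\<beta>\<close> expresses that
  \<open>\<Sum>\<^sub>k\<^sub>l B\<^sub>\<beta>\<^sub>l B\<^sub>\<alpha>\<^sub>k [H\<^sub>k, H\<^sub>l]\<close> vanishes; it is kept as an equation between two sums, to which the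
  cancellation applies directly.
\<close>

lemma separated_system_solutions_commute:
  assumes fin: "finite I" "finite A"
    and B: "\<And>\<alpha> i. \<alpha> \<in> A \<Longrightarrow> i \<in> I \<Longrightarrow> B \<alpha> i \<in> carrier R"
    and C: "\<And>\<alpha> i. \<alpha> \<in> A \<Longrightarrow> i \<in> I \<Longrightarrow> C i \<alpha> \<in> carrier R"
    and f: "\<And>\<alpha>. \<alpha> \<in> A \<Longrightarrow> f \<alpha> \<in> carrier R"
    and BC: "\<And>\<alpha> \<beta>. \<alpha> \<in> A \<Longrightarrow> \<beta> \<in> A \<Longrightarrow> (\<Oplus>i\<in>I. B \<alpha> i \<otimes> C i \<beta>) = (if \<alpha> = \<beta> then \<one> else \<zero>)"
    and CB: "\<And>i j. i \<in> I \<Longrightarrow> j \<in> I \<Longrightarrow> (\<Oplus>\<alpha>\<in>A. C i \<alpha> \<otimes> B \<alpha> j) = (if i = j then \<one> else \<zero>)"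
    and BB: "\<And>\<alpha> \<beta> i j. \<alpha> \<in> A \<Longrightarrow> \<beta> \<in> A \<Longrightarrow> i \<in> I \<Longrightarrow> j \<in> I \<Longrightarrow> B \<alpha> i \<otimes> B \<beta> j = B \<beta> j \<otimes> B \<alpha> i"
    and ff: "\<And>\<alpha> \<beta>. \<alpha> \<in> A \<Longrightarrow> \<beta> \<in> A \<Longrightarrow> f \<alpha> \<otimes> f \<beta> = f \<beta> \<otimes> f \<alpha>"
    and fB: "\<And>\<alpha> \<beta> i. \<alpha> \<in> A \<Longrightarrow> \<beta> \<in> A \<Longrightarrow> \<alpha> \<noteq> \<beta> \<Longrightarrow> i \<in> I \<Longrightarrow> f \<alpha> \<otimes> B \<beta> i = B \<beta> i \<otimes> f \<alpha>"
    and ij: "i \<in> I" "j \<in> I"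
  defines "H \<equiv> \<lambda>i. \<Oplus>\<alpha>\<in>A. C i \<alpha> \<otimes> f \<alpha>"
  shows "H i \<otimes> H j = H j \<otimes> H i"
proof -
  have H: "H k \<in> carrier R" if "k \<in> I" for k
    unfolding H_def using that C f by (auto intro!: finsum_closed)
  have BH: "(\<Oplus>k\<in>I. B \<alpha> k \<otimes> H k) = f \<alpha>" if \<alpha>: "\<alpha> \<in> A" for \<alpha>
  proof -
    have "(\<Oplus>k\<in>I. B \<alpha> k \<otimes> H k) = (\<Oplus>\<beta>\<in>A. (\<Oplus>k\<in>I. B \<alpha> k \<otimes> C k \<beta>) \<otimes> f \<beta>)"
      unfolding H_def using fin B C f \<alpha> by (intro matrix_action_assoc) auto
    also have "\<dots> = (\<Oplus>\<beta>\<in>A. (if \<alpha> = \<beta> then \<one> else \<zero>) \<otimes> f \<beta>)"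
      using BC \<alpha> f by (intro finsum_cong') auto
    finally show ?thesis
      using finsum_delta_mult[of A \<alpha> f] fin \<alpha> f by simp
  qed
  have BHx: "(\<Oplus>k\<in>I. B \<alpha> k \<otimes> (H k \<otimes> x)) = f \<alpha> \<otimes> x" if "\<alpha> \<in> A" "x \<in> carrier R" for \<alpha> x
  proof -
    have "f \<alpha> \<otimes> x = (\<Oplus>k\<in>I. B \<alpha> k \<otimes> H k \<otimes> x)"
      using that fin B H by (simp add: BH[symmetric] finsum_ldistr Pi_def)
    also have "\<dots> = (\<Oplus>k\<in>I. B \<alpha> k \<otimes> (H k \<otimes> x))"
      using that B H by (intro finsum_cong') (auto simp: m_assoc)
    finally show ?thesis ..
  qed
  define T where "T \<alpha> \<beta> = (\<Oplus>l\<in>I. B \<beta> l \<otimes> (\<Oplus>k\<in>I. B \<alpha> k \<otimes> (H k \<otimes> H l)))" for \<alpha> \<beta>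
  have T: "T \<alpha> \<beta> = f \<alpha> \<otimes> f \<beta>" if \<alpha>\<beta>: "\<alpha> \<in> A" "\<beta> \<in> A" "\<alpha> \<noteq> \<beta>" for \<alpha> \<beta>
  proof -
    have "T \<alpha> \<beta> = (\<Oplus>l\<in>I. f \<alpha> \<otimes> (B \<beta> l \<otimes> H l))"
      unfolding T_def using \<alpha>\<beta> B H f fB BHx
      by (intro finsum_cong') (auto simp: m_assoc[symmetric])
    also have "\<dots> = f \<alpha> \<otimes> (\<Oplus>l\<in>I. B \<beta> l \<otimes> H l)"
      using \<alpha>\<beta> fin B H f by (simp add: finsum_rdistr Pi_def)
    finally show ?thesis
      using \<alpha>\<beta> by (simp add: BH)
  qed
  have Tsym: "T \<alpha> \<beta> = T \<beta> \<alpha>" if "\<alpha> \<in> A" "\<beta> \<in> A" for \<alpha> \<beta>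
    using that T ff by (cases "\<alpha> = \<beta>") auto
  \<comment> \<open>Interchanging the summations reverses the order of the two entries of \<open>B\<close>; as they commute, the
    result is \<open>T \<alpha> \<beta>\<close> with the factors \<open>H\<close> exchanged.\<close>
  have swap: "T \<beta> \<alpha> = (\<Oplus>l\<in>I. B \<beta> l \<otimes> (\<Oplus>k\<in>I. B \<alpha> k \<otimes> (H l \<otimes> H k)))"
    if \<alpha>\<beta>: "\<alpha> \<in> A" "\<beta> \<in> A" for \<alpha> \<beta>
  proof -
    have "T \<beta> \<alpha> = (\<Oplus>k\<in>I. \<Oplus>l\<in>I. B \<alpha> k \<otimes> (B \<beta> l \<otimes> (H l \<otimes> H k)))"
      unfolding T_def using \<alpha>\<beta> fin B H by (intro finsum_cong') (auto simp: finsum_rdistr Pi_def)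
    also have "\<dots> = (\<Oplus>l\<in>I. \<Oplus>k\<in>I. B \<alpha> k \<otimes> (B \<beta> l \<otimes> (H l \<otimes> H k)))"
      using \<alpha>\<beta> fin B H by (intro finsum_swap) auto
    also have "\<dots> = (\<Oplus>l\<in>I. \<Oplus>k\<in>I. B \<beta> l \<otimes> (B \<alpha> k \<otimes> (H l \<otimes> H k)))"
    proof (intro finsum_cong' refl)
      fix l k assume "l \<in> I" "k \<in> I"
      then show "B \<alpha> k \<otimes> (B \<beta> l \<otimes> (H l \<otimes> H k)) = B \<beta> l \<otimes> (B \<alpha> k \<otimes> (H l \<otimes> H k))"
        using \<alpha>\<beta> B H BB[of \<alpha> \<beta> k l] m_assoc[of "B \<alpha> k" "B \<beta> l" "H l \<otimes> H k"]
          m_assoc[of "B \<beta> l" "B \<alpha> k" "H l \<otimes> H k"] by simp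
    qed (use \<alpha>\<beta> B H in \<open>auto intro!: finsum_closed\<close>)
    also have "\<dots> = (\<Oplus>l\<in>I. B \<beta> l \<otimes> (\<Oplus>k\<in>I. B \<alpha> k \<otimes> (H l \<otimes> H k)))"
      using \<alpha>\<beta> fin B H by (intro finsum_cong') (auto simp: finsum_rdistr Pi_def)
    finally show ?thesis .
  qed
  \<comment> \<open>First \<open>B \<beta>\<close> is cancelled for fixed \<open>\<alpha>\<close>, which leaves one system for each row \<open>\<alpha>\<close>; then
    \<open>B \<alpha>\<close> itself.\<close>
  have row: "(\<Oplus>k\<in>I. B \<alpha> k \<otimes> (H k \<otimes> H j)) = (\<Oplus>k\<in>I. B \<alpha> k \<otimes> (H j \<otimes> H k))"
    if \<alpha>: "\<alpha> \<in> A" for \<alpha>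
  proof (rule left_inverse_matrix_cancel[OF fin B C CB,
      where x = "\<lambda>l. \<Oplus>k\<in>I. B \<alpha> k \<otimes> (H k \<otimes> H l)" and y = "\<lambda>l. \<Oplus>k\<in>I. B \<alpha> k \<otimes> (H l \<otimes> H k)"])
    fix \<beta> assume "\<beta> \<in> A"
    then show "(\<Oplus>l\<in>I. B \<beta> l \<otimes> (\<Oplus>k\<in>I. B \<alpha> k \<otimes> (H k \<otimes> H l))) =
        (\<Oplus>l\<in>I. B \<beta> l \<otimes> (\<Oplus>k\<in>I. B \<alpha> k \<otimes> (H l \<otimes> H k)))"
      using \<alpha> Tsym[of \<alpha> \<beta>] swap[of \<alpha> \<beta>] by (simp add: T_def)
  qed (use \<alpha> ij B H in \<open>auto intro!: finsum_closed\<close>)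
  show ?thesis
    by (rule left_inverse_matrix_cancel[OF fin B C CB,
          where x = "\<lambda>k. H k \<otimes> H j" and y = "\<lambda>k. H j \<otimes> H k" and k = i])
       (use ij H row in auto)
qed

end

section \<open>Calculation in the Weyl-like algebra\<close>

abbreviation multi_unit :: "'n \<Rightarrow> 'n \<Rightarrow> nat" where
  "multi_unit \<gamma> \<equiv> \<lambda>\<beta>. if \<beta> = \<gamma> then 1 else 0"

lemma weyl_fun_in_carrier: "weyl_fun F \<in> carrier (weyl_algebra \<eta>)"
  by (simp add: weyl_algebra_def weyl_fun_def)

lemma weyl_gen_in_carrier: "weyl_gen \<gamma> \<in> carrier (weyl_algebra \<eta>)"
  by (simp add: weyl_algebra_def weyl_gen_def)

lemma weyl_fun_mult_apply: "(weyl_fun F \<otimes>\<^bsub>weyl_algebra \<eta>\<^esub> x) k = F * x k"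
proof -
  have "(weyl_fun F \<otimes>\<^bsub>weyl_algebra \<eta>\<^esub> x) k =
      (\<Sum>m | \<forall>\<alpha>. m \<alpha> \<le> k \<alpha>. if m = (\<lambda>_. 0) then F * x k else 0)"
    unfolding weyl_algebra_def weyl_fun_def ring.simps monoid.simps
    by (rule sum.cong) (auto simp: weyl_shift_0)
  then show ?thesis
    by (simp add: finite_le_multiindex)
qed

lemma weyl_fun_mult: "weyl_fun F \<otimes>\<^bsub>weyl_algebra \<eta>\<^esub> weyl_fun G = weyl_fun (F * G)"
  by (rule ext) (simp add: weyl_fun_mult_apply, simp add: weyl_fun_def)

lemma weyl_fun_one: "\<one>\<^bsub>weyl_algebra \<eta>\<^esub> = weyl_fun 1"
  by (simp add: weyl_algebra_def weyl_fun_def)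

lemma weyl_fun_zero: "\<zero>\<^bsub>weyl_algebra \<eta>\<^esub> = weyl_fun 0"
  by (simp add: weyl_algebra_def weyl_fun_def)

lemma weyl_add_apply: "(x \<oplus>\<^bsub>weyl_algebra \<eta>\<^esub> y) m = x m + y m"
  and weyl_zero_apply: "\<zero>\<^bsub>weyl_algebra \<eta>\<^esub> m = 0"
  by (simp_all add: weyl_algebra_def)

lemma weyl_finsum_apply:
  fixes x :: "'i \<Rightarrow> 'n::finite weyl"
  assumes "\<And>a. a \<in> A \<Longrightarrow> x a \<in> carrier (weyl_algebra \<eta>)"
  shows "(\<Oplus>\<^bsub>weyl_algebra \<eta>\<^esub>a\<in>A. x a) m = (\<Sum>a\<in>A. x a m)"
proof -
  interpret ring "weyl_algebra \<eta> :: 'n weyl ring" by (rule ring_weyl_algebra)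
  show ?thesis
    using assms
    by (induction A rule: infinite_finite_induct)
       (auto simp: finsum_insert Pi_def finsum_infinite weyl_add_apply weyl_zero_apply)
qed

lemma weyl_fun_finsum:
  fixes F :: "'i \<Rightarrow> 'n::finite mero"
  shows "(\<Oplus>\<^bsub>weyl_algebra \<eta>\<^esub>a\<in>A. weyl_fun (F a)) = weyl_fun (\<Sum>a\<in>A. F a)"
  by (rule ext) (simp add: weyl_finsum_apply weyl_fun_in_carrier, simp add: weyl_fun_def)

lemma weyl_add_pow_apply:
  fixes x :: "'n::finite weyl" and k :: int
  assumes x: "x \<in> carrier (weyl_algebra \<eta>)"
  shows "([k] \<cdot>\<^bsub>weyl_algebra \<eta>\<^esub> x) m = of_int k * x m"
proof -
  interpret ring "weyl_algebra \<eta> :: 'n weyl ring" by (rule ring_weyl_algebra)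
  have nat: "([n] \<cdot>\<^bsub>weyl_algebra \<eta>\<^esub> x) m = of_nat n * x m" for n :: nat
    by (induction n) (simp_all add: weyl_add_apply weyl_zero_apply algebra_simps)
  have neg: "(\<ominus>\<^bsub>weyl_algebra \<eta>\<^esub> y) m = - y m" if "y \<in> carrier (weyl_algebra \<eta>)" for y :: "'n weyl"
    using fun_cong[OF r_neg[OF that], of m]
    by (simp add: weyl_add_apply weyl_zero_apply eq_neg_iff_add_eq_0 add.commute)
  show ?thesis
  proof (cases "k \<ge> 0")
    case True
    then show ?thesis
      using nat[of "nat k"] by (simp add: add_pow_int_ge)
  next
    case False
    then show ?thesis
      using nat[of "nat (- k)"] neg[of "[nat (- k)] \<cdot>\<^bsub>weyl_algebra \<eta>\<^esub> x"] x
      by (simp add: add_pow_int_lt)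
  qed
qed

text \<open>
  Both products are the monomial \<open>f\<^sub>\<alpha> f\<^sub>\<beta>\<close> with coefficient 1, because shifts fix the constant 1.
\<close>

lemma weyl_gen_commute:
  "weyl_gen \<alpha> \<otimes>\<^bsub>weyl_algebra \<eta>\<^esub> weyl_gen \<beta> =
   (weyl_gen \<beta> \<otimes>\<^bsub>weyl_algebra \<eta>\<^esub> weyl_gen \<alpha> :: 'n::finite weyl)"
proof -
  have *: "(weyl_gen \<alpha> \<otimes>\<^bsub>weyl_algebra \<eta>\<^esub> weyl_gen \<beta>) k =
      (if k = (\<lambda>\<gamma>. multi_unit \<alpha> \<gamma> + multi_unit \<beta> \<gamma>) then 1 else 0 :: 'n mero)" for \<alpha> \<beta> k
  proof -
    have "(weyl_gen \<alpha> \<otimes>\<^bsub>weyl_algebra \<eta>\<^esub> weyl_gen \<beta>) k =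
        (\<Sum>m | \<forall>\<alpha>. m \<alpha> \<le> k \<alpha>. if m = multi_unit \<alpha> then
          (if k = (\<lambda>\<gamma>. multi_unit \<alpha> \<gamma> + multi_unit \<beta> \<gamma>) then 1 else 0 :: 'n mero) else 0)"
      unfolding weyl_algebra_def weyl_gen_def ring.simps monoid.simps
    proof (rule sum.cong[OF refl])
      fix m assume "m \<in> {m. \<forall>\<alpha>. m \<alpha> \<le> k \<alpha>}"
      then have "k \<gamma> - m \<gamma> = multi_unit \<beta> \<gamma> \<longleftrightarrow> k \<gamma> = m \<gamma> + multi_unit \<beta> \<gamma>" for \<gamma>
        by (auto dest: spec[of _ \<gamma>])
      then have "(\<lambda>\<gamma>. k \<gamma> - m \<gamma>) = multi_unit \<beta> \<longleftrightarrow> k = (\<lambda>\<gamma>. m \<gamma> + multi_unit \<beta> \<gamma>)"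
        unfolding fun_eq_iff by blast
      then show "(if m = multi_unit \<alpha> then 1 else 0) *
          weyl_shift \<eta> m (if (\<lambda>\<gamma>. k \<gamma> - m \<gamma>) = multi_unit \<beta> then 1 else 0) =
        (if m = multi_unit \<alpha> then
          (if k = (\<lambda>\<gamma>. multi_unit \<alpha> \<gamma> + multi_unit \<beta> \<gamma>) then 1 else 0) else 0)"
        by (cases "m = multi_unit \<alpha>"; cases "k = (\<lambda>\<gamma>. m \<gamma> + multi_unit \<beta> \<gamma>)")
          (simp_all only: weyl_shift_hom if_True if_False simp_thms mult_1 mult_zero_left mult_zero_right)
    qed
    also have "\<dots> = (if k = (\<lambda>\<gamma>. multi_unit \<alpha> \<gamma> + multi_unit \<beta> \<gamma>) then 1 else 0)"
      by (auto simp: finite_le_multiindex)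
    finally show ?thesis .
  qed
  show ?thesis
    by (rule ext) (simp only: * add.commute)
qed

lemma weyl_fun_apply: "weyl_fun F m = (if m = (\<lambda>_. 0) then F else 0)"
  by (simp add: weyl_fun_def)

lemma weyl_fun_uminus:
  fixes F :: "'n::finite mero"
  shows "weyl_fun (- F) = \<ominus>\<^bsub>weyl_algebra \<eta>\<^esub> weyl_fun F"
proof -
  interpret ring "weyl_algebra \<eta> :: 'n weyl ring" by (rule ring_weyl_algebra)
  have "weyl_fun (- F) \<oplus>\<^bsub>weyl_algebra \<eta>\<^esub> weyl_fun F = \<zero>\<^bsub>weyl_algebra \<eta>\<^esub>"
    by (rule ext) (auto simp: weyl_add_apply weyl_zero_apply weyl_fun_apply)
  then show ?thesis
    using minus_equality[OF _ weyl_fun_in_carrier weyl_fun_in_carrier] by metis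
qed

section \<open>Classes of holomorphic functions\<close>

lemma mero_of_hom:
  assumes "meromorphic_cn F" "meromorphic_cn G"
  shows "mero_of F + mero_of G = mero_of (\<lambda>z. F z + G z)"
    and "mero_of F * mero_of G = mero_of (\<lambda>z. F z * G z)"
  unfolding mero_of_def using assms
  by (simp_all add: plus_mero.abs_eq times_mero.abs_eq mero_eq_refl)

lemma mero_of_const: "mero_of (\<lambda>_. 0) = 0" "mero_of (\<lambda>_. 1) = 1"
  by (simp_all add: mero_of_def zero_mero.abs_eq one_mero.abs_eq zero_mero_def one_mero_def)

lemma mero_of_uminus: "meromorphic_cn F \<Longrightarrow> - mero_of F = mero_of (\<lambda>z. - F z)"
  unfolding mero_of_def by (simp add: uminus_mero.abs_eq mero_eq_refl)

lemma shift_mero_of: "meromorphic_cn F \<Longrightarrow> shift_mero a (mero_of F) = mero_of (\<lambda>z. F (z - a))"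
  unfolding mero_of_def by (simp add: shift_mero.abs_eq mero_eq_refl)

lemma holomorphic_cn_sum:
  "(\<And>a. a \<in> A \<Longrightarrow> holomorphic_cn (f a) U) \<Longrightarrow> holomorphic_cn (\<lambda>z. \<Sum>a\<in>A. f a z) U"
  by (induction A rule: infinite_finite_induct) (auto intro: holomorphic_cn_const holomorphic_cn_add)

lemma holomorphic_cn_prod:
  "(\<And>a. a \<in> A \<Longrightarrow> holomorphic_cn (f a) U) \<Longrightarrow> holomorphic_cn (\<lambda>z. \<Prod>a\<in>A. f a z) U"
  by (induction A rule: infinite_finite_induct) (auto intro: holomorphic_cn_const holomorphic_cn_mult)

lemma mero_of_sum:
  "(\<And>a. a \<in> A \<Longrightarrow> holomorphic_cn (f a) UNIV) \<Longrightarrow> (\<Sum>a\<in>A. mero_of (f a)) = mero_of (\<lambda>z. \<Sum>a\<in>A. f a z)"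
  by (induction A rule: infinite_finite_induct)
     (auto simp: mero_of_const mero_of_hom meromorphic_cn_holomorphic holomorphic_cn_sum)

lemma mero_of_prod:
  "(\<And>a. a \<in> A \<Longrightarrow> holomorphic_cn (f a) UNIV) \<Longrightarrow> (\<Prod>a\<in>A. mero_of (f a)) = mero_of (\<lambda>z. \<Prod>a\<in>A. f a z)"
  by (induction A rule: infinite_finite_induct)
     (auto simp: mero_of_const mero_of_hom meromorphic_cn_holomorphic holomorphic_cn_prod)

lemma mero_of_int: "of_int k = mero_of (\<lambda>_. of_int k)"
proof -
  have nat: "of_nat m = mero_of (\<lambda>_. of_nat m)" for m
  proof (induction m)
    case 0
    show ?case by (simp add: mero_of_const)
  next
    case (Suc m)
    have "mero_of (\<lambda>_. 1) + mero_of (\<lambda>_. of_nat m) = mero_of (\<lambda>_. 1 + of_nat m)"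
      by (rule mero_of_hom) (rule meromorphic_cn_const)+
    then show ?case
      by (simp only: of_nat_Suc Suc mero_of_const)
  qed
  show ?thesis
    by (cases k) (simp_all only: nat of_int_of_nat_eq of_int_minus mero_of_uminus meromorphic_cn_const)
qed

lemma
  assumes "\<And>\<alpha> j. \<alpha> < n \<Longrightarrow> j < n \<Longrightarrow> holomorphic_cn (g \<alpha> j) UNIV"
  shows holomorphic_cn_det: "holomorphic_cn (\<lambda>z. det (mat n n (\<lambda>(\<alpha>, j). g \<alpha> j z))) UNIV"
    and mero_of_det: "det (mat n n (\<lambda>(\<alpha>, j). mero_of (g \<alpha> j))) =
      mero_of (\<lambda>z. det (mat n n (\<lambda>(\<alpha>, j). g \<alpha> j z)))"
proof -
  have *: "det (mat n n (\<lambda>(\<alpha>, j). h \<alpha> j)) =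
      (\<Sum>p | p permutes {0..<n}. of_int (sign p) * (\<Prod>\<alpha>=0..<n. h \<alpha> (p \<alpha>)))"
    for h :: "nat \<Rightarrow> nat \<Rightarrow> 'c::comm_ring_1"
    by (subst det_def'[of _ n]) (auto intro!: sum.cong prod.cong)
  have hol: "holomorphic_cn (\<lambda>z. \<Prod>\<alpha>=0..<n. g \<alpha> (p \<alpha>) z) UNIV" if "p permutes {0..<n}" for p
    using permutes_in_image[OF that] by (intro holomorphic_cn_prod assms) auto
  show "holomorphic_cn (\<lambda>z. det (mat n n (\<lambda>(\<alpha>, j). g \<alpha> j z))) UNIV"
    unfolding * by (intro holomorphic_cn_sum holomorphic_cn_mult holomorphic_cn_const hol) auto
  have "det (mat n n (\<lambda>(\<alpha>, j). mero_of (g \<alpha> j))) =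
      (\<Sum>p | p permutes {0..<n}. of_int (sign p) * mero_of (\<lambda>z. \<Prod>\<alpha>=0..<n. g \<alpha> (p \<alpha>) z))"
    unfolding *
  proof (intro sum.cong refl arg_cong2[where f = "(*)"] mero_of_prod assms)
    fix p \<alpha> assume "p \<in> {p. p permutes {0..<n}}" "\<alpha> \<in> {0..<n}"
    then show "\<alpha> < n" "p \<alpha> < n"
      using permutes_in_image[of p "{0..<n}" \<alpha>] by auto
  qed
  also have "\<dots> = (\<Sum>p | p permutes {0..<n}. mero_of (\<lambda>z. of_int (sign p) * (\<Prod>\<alpha>=0..<n. g \<alpha> (p \<alpha>) z)))"
    by (intro sum.cong refl)
       (simp only: mem_Collect_eq mero_of_int mero_of_hom meromorphic_cn_const meromorphic_cn_holomorphic hol)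
  also have "\<dots> = mero_of (\<lambda>z. \<Sum>p | p permutes {0..<n}. of_int (sign p) * (\<Prod>\<alpha>=0..<n. g \<alpha> (p \<alpha>) z))"
    by (intro mero_of_sum holomorphic_cn_mult holomorphic_cn_const hol) auto
  finally show "det (mat n n (\<lambda>(\<alpha>, j). mero_of (g \<alpha> j))) =
      mero_of (\<lambda>z. det (mat n n (\<lambda>(\<alpha>, j). g \<alpha> j z)))"
    unfolding * .
qed

text \<open>
  The reciprocal is meromorphic with the global representation \<open>1 / h\<close>. The product with \<open>h\<close> is
  the constant 1 only off the zero set of \<open>h\<close>, where division by zero gives the value 0; the
  hypothesis says precisely that the complement of the zero set is dense, so the classes agree.
\<close>

lemma mero_of_invertible:
  fixes h :: "complex ^ 'n::finite \<Rightarrow> complex"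
  assumes hol: "holomorphic_cn h UNIV"
    and nz: "\<And>W. open W \<Longrightarrow> W \<noteq> {} \<Longrightarrow> \<exists>z\<in>W. h z \<noteq> 0"
  shows "\<exists>u. mero_of h * u = 1"
proof -
  have "meromorphic_cn (\<lambda>z. 1 / h z)"
    unfolding meromorphic_cn_def
    using hol nz by (intro allI exI[of _ UNIV] exI[of _ "\<lambda>_. 1"] exI[of _ h]) (auto simp: holomorphic_cn_const)
  with meromorphic_cn_holomorphic[OF hol]
  have "mero_of h * mero_of (\<lambda>z. 1 / h z) = mero_of (\<lambda>z. h z * (1 / h z))"
    and mer: "meromorphic_cn (\<lambda>z. h z * (1 / h z))"
    by (rule mero_of_hom, rule meromorphic_cn_mult)
  moreover have "mero_eq (\<lambda>z. h z * (1 / h z)) (\<lambda>_. 1)"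
  proof (rule mero_eqI[where S = "{z. h z \<noteq> 0}"])
    show "open {z. h z \<noteq> 0}"
      using holomorphic_cn_continuous_on[OF hol] by (intro open_Collect_neq) auto
    have "- closure {z. h z \<noteq> 0} = {}"
      using nz[of "- closure {z. h z \<noteq> 0}"] closure_subset[of "{z. h z \<noteq> 0}"] by (auto simp: open_Compl)
    then show "closure {z. h z \<noteq> 0} = UNIV" by auto
  qed (use mer meromorphic_cn_const in auto)
  then have "mero_of (\<lambda>z. h z * (1 / h z)) = mero_of (\<lambda>_. 1)"
    unfolding mero_of_def by (rule Quotient3_rel_abs[OF Quotient3_mero])
  ultimately have "mero_of h * mero_of (\<lambda>z. 1 / h z) = 1"
    by (simp only: mero_of_const)
  then show ?thesis ..
qed

lemma holomorphic_cn_coordinate: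
  fixes f :: "complex \<Rightarrow> complex" and \<gamma> :: "'n::finite"
  assumes "f holomorphic_on UNIV"
  shows "holomorphic_cn (\<lambda>z. f (vec_nth z \<gamma>)) UNIV"
  unfolding holomorphic_cn_def
proof
  fix z :: "complex ^ 'n"
  have "(f has_field_derivative deriv f (vec_nth z \<gamma>)) (at (vec_nth z \<gamma>))"
    using assms by (simp add: holomorphic_derivI)
  then have "(f has_derivative (\<lambda>h. deriv f (vec_nth z \<gamma>) * h)) (at (vec_nth z \<gamma>))"
    by (simp add: has_field_derivative_def)
  moreover have "((\<lambda>z. vec_nth z \<gamma>) has_derivative (\<lambda>v. vec_nth v \<gamma>)) (at z)"
    by (intro bounded_linear_imp_has_derivative bounded_linear_vec_nth)
  ultimately have "((\<lambda>z. f (vec_nth z \<gamma>)) has_derivative (\<lambda>v. deriv f (vec_nth z \<gamma>) * vec_nth v \<gamma>)) (at z)"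
    using has_derivative_compose by blast
  then show "\<exists>f'. ((\<lambda>z. f (vec_nth z \<gamma>)) has_derivative f') (at z) \<and> (\<forall>c v. f' (c *s v) = c * f' v)"
    by (intro exI[of _ "\<lambda>v. deriv f (vec_nth z \<gamma>) * vec_nth v \<gamma>"]) auto
qed

text \<open>
  The shift belonging to \<open>\<gamma>\<close> moves only the coordinate \<open>\<gamma>\<close>. This is what separates the rows: the
  generator of one row commutes with the theta functions in every other row.
\<close>

lemma weyl_gen_commute_other_coordinate:
  fixes f :: "complex \<Rightarrow> complex" and \<gamma> \<delta> :: "'n::finite"
  assumes "f holomorphic_on UNIV" "\<gamma> \<noteq> \<delta>"
  shows "weyl_gen \<gamma> \<otimes>\<^bsub>weyl_algebra \<eta>\<^esub> weyl_fun (mero_of (\<lambda>z. f (vec_nth z \<delta>))) =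
    weyl_fun (mero_of (\<lambda>z. f (vec_nth z \<delta>))) \<otimes>\<^bsub>weyl_algebra \<eta>\<^esub> weyl_gen \<gamma>"
proof -
  have "meromorphic_cn (\<lambda>z. f (vec_nth z \<delta>))"
    using assms(1) by (intro meromorphic_cn_holomorphic holomorphic_cn_coordinate)
  then show ?thesis
    using assms(2) by (simp add: weyl_gen_weyl_fun shift_mero_of)
qed

section \<open>Determinants with a column of generators\<close>

lemma (in monoid) foldr_mult_closed:
  "(\<And>x. x \<in> set xs \<Longrightarrow> g x \<in> carrier G) \<Longrightarrow> foldr (\<lambda>x y. x \<otimes> y) (map g xs) \<one> \<in> carrier G"
  by (induction xs) auto

lemma (in monoid) foldr_mult_commute:
  assumes "\<And>x. x \<in> set xs \<Longrightarrow> g x \<in> carrier G" "c \<in> carrier G"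
    and "\<And>x. x \<in> set xs \<Longrightarrow> c \<otimes> g x = g x \<otimes> c"
  shows "c \<otimes> foldr (\<lambda>x y. x \<otimes> y) (map g xs) \<one> = foldr (\<lambda>x y. x \<otimes> y) (map g xs) \<one> \<otimes> c"
  using assms
proof (induction xs)
  case Nil
  then show ?case by simp
next
  case (Cons a xs)
  let ?P = "foldr (\<lambda>x y. x \<otimes> y) (map g xs) \<one>"
  have P: "?P \<in> carrier G"
    using Cons.prems by (intro foldr_mult_closed) auto
  have a: "g a \<in> carrier G" "c \<otimes> g a = g a \<otimes> c"
    using Cons.prems by auto
  have "c \<otimes> (g a \<otimes> ?P) = g a \<otimes> (c \<otimes> ?P)"
    using P a \<open>c \<in> carrier G\<close> by (metis m_assoc)
  also have "c \<otimes> ?P = ?P \<otimes> c"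
    using Cons.prems by (intro Cons.IH) auto
  finally show ?case
    using P a \<open>c \<in> carrier G\<close> by (simp add: m_assoc)
qed

text \<open>
  In a product with a fixed order, a factor that commutes with the others can be evaluated last;
  replacing it by 1 keeps the remaining factors indexed by the same list.
\<close>

lemma (in monoid) foldr_mult_move_to_end:
  assumes "distinct xs" "c \<in> set xs" "\<And>x. x \<in> set xs \<Longrightarrow> g x \<in> carrier G"
    and "\<And>x. x \<in> set xs \<Longrightarrow> x \<noteq> c \<Longrightarrow> g c \<otimes> g x = g x \<otimes> g c"
  shows "foldr (\<lambda>x y. x \<otimes> y) (map g xs) \<one> =
    foldr (\<lambda>x y. x \<otimes> y) (map (g(c := \<one>)) xs) \<one> \<otimes> g c"
  using assms
proof (induction xs)
  case Nil
  then show ?case by simp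
next
  case (Cons a xs)
  show ?case
  proof (cases "a = c")
    case True
    then have c: "c \<notin> set xs" using Cons.prems(1) by auto
    have "g c \<otimes> foldr (\<lambda>x y. x \<otimes> y) (map g xs) \<one> = foldr (\<lambda>x y. x \<otimes> y) (map g xs) \<one> \<otimes> g c"
      using Cons.prems c by (intro foldr_mult_commute) (auto simp: True)
    moreover have eq: "map (g(c := \<one>)) xs = map g xs"
      using c by (intro map_cong) auto
    moreover have "foldr (\<lambda>x y. x \<otimes> y) (map g xs) \<one> \<in> carrier G"
      using Cons.prems by (intro foldr_mult_closed) auto
    ultimately show ?thesis
      unfolding True list.map foldr.simps o_apply eq fun_upd_same by simp
  next
    case False
    have "foldr (\<lambda>x y. x \<otimes> y) (map (g(c := \<one>)) xs) \<one> \<in> carrier G"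
      using Cons.prems by (intro foldr_mult_closed) auto
    moreover have "foldr (\<lambda>x y. x \<otimes> y) (map g xs) \<one> =
        foldr (\<lambda>x y. x \<otimes> y) (map (g(c := \<one>)) xs) \<one> \<otimes> g c"
      using False Cons.prems by (intro Cons.IH) auto
    moreover have "g a \<in> carrier G" "g c \<in> carrier G"
      using Cons.prems by auto
    moreover have "(g(c := \<one>)) a = g a"
      using False by simp
    ultimately show ?thesis
      unfolding list.map foldr.simps o_apply by (simp only: m_assoc)
  qed
qed

lemma foldr_weyl_fun:
  "distinct xs \<Longrightarrow> foldr (\<lambda>x y. x \<otimes>\<^bsub>weyl_algebra \<eta>\<^esub> y) (map (\<lambda>\<alpha>. weyl_fun (F \<alpha>)) xs) \<one>\<^bsub>weyl_algebra \<eta>\<^esub> =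
    weyl_fun (\<Prod>\<alpha>\<in>set xs. F \<alpha>)"
  by (induction xs) (simp_all add: weyl_fun_one weyl_fun_mult)

lemma nc_det_apply:
  fixes A :: "nat \<Rightarrow> nat \<Rightarrow> 'n::finite weyl"
  assumes "\<And>\<alpha> j. \<alpha> < n \<Longrightarrow> j < n \<Longrightarrow> A \<alpha> j \<in> carrier (weyl_algebra \<eta>)"
  shows "nc_det (weyl_algebra \<eta>) n A m = (\<Sum>p | p permutes {0..<n}. of_int (sign p) *
    foldr (\<lambda>x y. x \<otimes>\<^bsub>weyl_algebra \<eta>\<^esub> y) (map (\<lambda>\<alpha>. A \<alpha> (p \<alpha>)) [0..<n]) \<one>\<^bsub>weyl_algebra \<eta>\<^esub> m)"
proof -
  interpret ring "weyl_algebra \<eta> :: 'n weyl ring" by (rule ring_weyl_algebra)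
  have *: "foldr (\<lambda>x y. x \<otimes>\<^bsub>weyl_algebra \<eta>\<^esub> y) (map (\<lambda>\<alpha>. A \<alpha> (p \<alpha>)) [0..<n]) \<one>\<^bsub>weyl_algebra \<eta>\<^esub>
      \<in> carrier (weyl_algebra \<eta>)" if p: "p permutes {0..<n}" for p
  proof (rule foldr_mult_closed)
    fix x assume "x \<in> set [0..<n]"
    then show "A x (p x) \<in> carrier (weyl_algebra \<eta>)"
      using permutes_in_image[OF p, of x] by (intro assms) auto
  qed
  show ?thesis
    unfolding nc_det_def lessThan_atLeast0
    using * by (subst weyl_finsum_apply) (auto intro!: sum.cong simp: weyl_add_pow_apply add.int_pow_closed)
qed

lemma nc_det_weyl_fun:
  fixes b :: "nat \<Rightarrow> nat \<Rightarrow> 'n::finite mero"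
  shows "nc_det (weyl_algebra \<eta>) n (\<lambda>\<alpha> j. weyl_fun (b \<alpha> j)) = weyl_fun (det (mat n n (\<lambda>(\<alpha>, j). b \<alpha> j)))"
proof
  fix m
  have "nc_det (weyl_algebra \<eta>) n (\<lambda>\<alpha> j. weyl_fun (b \<alpha> j)) m =
     (\<Sum>p | p permutes {0..<n}. of_int (sign p) * weyl_fun (\<Prod>\<alpha>=0..<n. b \<alpha> (p \<alpha>)) m)"
    by (subst nc_det_apply) (simp_all add: weyl_fun_in_carrier foldr_weyl_fun)
  also have "\<dots> = (if m = (\<lambda>_. 0) then
      \<Sum>p | p permutes {0..<n}. of_int (sign p) * (\<Prod>\<alpha>=0..<n. b \<alpha> (p \<alpha>)) else 0)"
    by (simp add: weyl_fun_apply)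
  also have "(\<Sum>p | p permutes {0..<n}. of_int (sign p) * (\<Prod>\<alpha>=0..<n. b \<alpha> (p \<alpha>))) =
      det (mat n n (\<lambda>(\<alpha>, j). b \<alpha> j))"
    by (subst det_def'[of _ n])
       (auto intro!: sum.cong prod.cong simp: permutes_in_image)
  finally show "nc_det (weyl_algebra \<eta>) n (\<lambda>\<alpha> j. weyl_fun (b \<alpha> j)) m =
      weyl_fun (det (mat n n (\<lambda>(\<alpha>, j). b \<alpha> j))) m"
    by (simp only: weyl_fun_apply[where m = m])
qed

text \<open>
  In the expansion of a determinant with a column of generators, the coefficient of one generator
  is the determinant with that column replaced by a unit vector, hence a signed minor.
\<close>

lemma det_unit_last_column:
  fixes b :: "nat \<Rightarrow> nat \<Rightarrow> 'a::comm_ring_1"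
  assumes "\<alpha> < Suc l"
  shows "det (mat (Suc l) (Suc l) (\<lambda>(\<beta>, j). if j = l then (if \<beta> = \<alpha> then 1 else 0) else b \<beta> j)) =
    (-1) ^ (\<alpha> + l) * det (mat_delete (mat (Suc l) (Suc l) (\<lambda>(\<beta>, j). b \<beta> j)) \<alpha> l)"
proof -
  let ?N = "mat (Suc l) (Suc l) (\<lambda>(\<beta>, j). if j = l then (if \<beta> = \<alpha> then 1 else 0) else b \<beta> j)"
  have "det ?N = (\<Sum>\<beta><Suc l. ?N $$ (\<beta>, l) * cofactor ?N \<beta> l)"
    by (rule laplace_expansion_column) auto
  also have "\<dots> = (\<Sum>\<beta><Suc l. if \<beta> = \<alpha> then cofactor ?N \<alpha> l else 0)"
    by (rule sum.cong) auto
  also have "\<dots> = cofactor ?N \<alpha> l"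
    using assms by simp
  also have "mat_delete ?N \<alpha> l = mat_delete (mat (Suc l) (Suc l) (\<lambda>(\<beta>, j). b \<beta> j)) \<alpha> l"
    by (rule eq_matI) (auto simp: mat_delete_def)
  then have "cofactor ?N \<alpha> l = (-1) ^ (\<alpha> + l) * det (mat_delete (mat (Suc l) (Suc l) (\<lambda>(\<beta>, j). b \<beta> j)) \<alpha> l)"
    by (simp add: cofactor_def)
  finally show ?thesis .
qed

text \<open>
  Each product in the expansion contains exactly one generator, from the row \<open>c\<close> that the
  permutation sends to the last column. Moving it to the end leaves an ordinary product. To collect
  the terms by generator rather than by permutation, this product is written as a sum over all rows
  \<open>\<alpha>\<close> of the products for the matrix \<open>N \<alpha>\<close>, whose last column is a unit vector: only \<open>\<alpha> = c\<close>
  contributes.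
\<close>

lemma nc_det_generator_column:
  fixes b :: "nat \<Rightarrow> nat \<Rightarrow> 'n::finite mero" and \<gamma> :: "nat \<Rightarrow> 'n"
  assumes comm: "\<And>\<alpha> \<beta> j. \<alpha> < Suc l \<Longrightarrow> \<beta> < Suc l \<Longrightarrow> \<alpha> \<noteq> \<beta> \<Longrightarrow> j < l \<Longrightarrow>
      weyl_gen (\<gamma> \<alpha>) \<otimes>\<^bsub>weyl_algebra \<eta>\<^esub> weyl_fun (b \<beta> j) =
      weyl_fun (b \<beta> j) \<otimes>\<^bsub>weyl_algebra \<eta>\<^esub> weyl_gen (\<gamma> \<alpha>)"
  shows "nc_det (weyl_algebra \<eta>) (Suc l) (\<lambda>\<alpha> j. if j = l then weyl_gen (\<gamma> \<alpha>) else weyl_fun (b \<alpha> j)) =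
    (\<Oplus>\<^bsub>weyl_algebra \<eta>\<^esub>\<alpha>\<in>{..<Suc l}.
      weyl_fun ((-1) ^ (\<alpha> + l) * det (mat_delete (mat (Suc l) (Suc l) (\<lambda>(\<beta>, j). b \<beta> j)) \<alpha> l))
      \<otimes>\<^bsub>weyl_algebra \<eta>\<^esub> weyl_gen (\<gamma> \<alpha>))"
    (is "nc_det ?W _ ?A = _")
proof
  fix m
  interpret ring ?W by (rule ring_weyl_algebra)
  let ?e = "\<lambda>\<alpha>. weyl_gen (\<gamma> \<alpha>) m"
  define N where "N \<alpha> = mat (Suc l) (Suc l) (\<lambda>(\<beta>, j). if j = l then (if \<beta> = \<alpha> then 1 else 0) else b \<beta> j)" for \<alpha>
  have prod: "foldr (\<lambda>x y. x \<otimes>\<^bsub>?W\<^esub> y) (map (\<lambda>\<alpha>. ?A \<alpha> (p \<alpha>)) [0..<Suc l]) \<one>\<^bsub>?W\<^esub> m =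
      (\<Sum>\<alpha><Suc l. (\<Prod>\<beta>=0..<Suc l. N \<alpha> $$ (\<beta>, p \<beta>)) * ?e \<alpha>)" if p: "p permutes {0..<Suc l}" for p
  proof -
    define c where "c = inv_into UNIV p l"
    have pc: "p c = l"
      unfolding c_def using p by (simp add: permutes_inverses)
    have c: "c < Suc l"
      using permutes_in_image[OF p, of c] pc by simp
    have p_less: "p \<beta> < l" if "\<beta> < Suc l" "\<beta> \<noteq> c" for \<beta>
    proof -
      have "p \<beta> \<noteq> l"
        using that pc permutes_inj[OF p] by (metis injD)
      moreover have "p \<beta> < Suc l"
        using that permutes_in_image[OF p, of \<beta>] by simp
      ultimately show ?thesis by simp
    qed
    let ?g = "\<lambda>\<alpha>. ?A \<alpha> (p \<alpha>)"
    have "foldr (\<lambda>x y. x \<otimes>\<^bsub>?W\<^esub> y) (map ?g [0..<Suc l]) \<one>\<^bsub>?W\<^esub> =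
        foldr (\<lambda>x y. x \<otimes>\<^bsub>?W\<^esub> y) (map (?g(c := \<one>\<^bsub>?W\<^esub>)) [0..<Suc l]) \<one>\<^bsub>?W\<^esub> \<otimes>\<^bsub>?W\<^esub> ?g c"
    proof (rule foldr_mult_move_to_end)
      fix x assume "x \<in> set [0..<Suc l]"
      then have x: "x < Suc l" by auto
      show "?g x \<in> carrier ?W"
        by (simp add: weyl_fun_in_carrier weyl_gen_in_carrier)
      assume "x \<noteq> c"
      then show "?g c \<otimes>\<^bsub>?W\<^esub> ?g x = ?g x \<otimes>\<^bsub>?W\<^esub> ?g c"
        using p_less[OF x] comm[OF c x _ p_less[OF x]] pc by simp
    qed (use c in auto)
    also have "map (?g(c := \<one>\<^bsub>?W\<^esub>)) [0..<Suc l] =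
        map (\<lambda>\<beta>. weyl_fun (if \<beta> = c then 1 else b \<beta> (p \<beta>))) [0..<Suc l]"
      using p_less by (intro map_cong refl) (fastforce simp: weyl_fun_one)
    finally have "foldr (\<lambda>x y. x \<otimes>\<^bsub>?W\<^esub> y) (map ?g [0..<Suc l]) \<one>\<^bsub>?W\<^esub> m =
        (\<Prod>\<beta>=0..<Suc l. if \<beta> = c then 1 else b \<beta> (p \<beta>)) * ?e c"
      by (simp only: foldr_weyl_fun[OF distinct_upt] set_upt weyl_fun_mult_apply pc if_True refl)
    moreover have "(\<Prod>\<beta>=0..<Suc l. N \<alpha> $$ (\<beta>, p \<beta>)) =
        (if \<alpha> = c then \<Prod>\<beta>=0..<Suc l. if \<beta> = c then 1 else b \<beta> (p \<beta>) else 0)" if "\<alpha> < Suc l" for \<alpha>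
    proof (cases "\<alpha> = c")
      case True
      have "N \<alpha> $$ (\<beta>, p \<beta>) = (if \<beta> = c then 1 else b \<beta> (p \<beta>))" if "\<beta> \<in> {0..<Suc l}" for \<beta>
        using that p_less[of \<beta>] c pc True by (cases "\<beta> = c") (auto simp: N_def)
      then have "(\<Prod>\<beta>=0..<Suc l. N \<alpha> $$ (\<beta>, p \<beta>)) =
          (\<Prod>\<beta>=0..<Suc l. if \<beta> = c then 1 else b \<beta> (p \<beta>))"
        by (intro prod.cong refl)
      with True show ?thesis
        by (simp only: if_True refl)
    next
      case False
      then have "N \<alpha> $$ (c, p c) = 0"
        using c pc by (simp add: N_def)
      then have "(\<Prod>\<beta>=0..<Suc l. N \<alpha> $$ (\<beta>, p \<beta>)) = 0"
        using c by (intro prod_zero) auto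
      with False show ?thesis by simp
    qed
    then have "(\<Sum>\<alpha><Suc l. (\<Prod>\<beta>=0..<Suc l. N \<alpha> $$ (\<beta>, p \<beta>)) * ?e \<alpha>) =
        (\<Sum>\<alpha><Suc l. if \<alpha> = c then (\<Prod>\<beta>=0..<Suc l. if \<beta> = c then 1 else b \<beta> (p \<beta>)) * ?e c else 0)"
      by (intro sum.cong) auto
    ultimately show ?thesis
      using c by simp
  qed
  have "nc_det ?W (Suc l) ?A m = (\<Sum>p | p permutes {0..<Suc l}. of_int (sign p) *
      (\<Sum>\<alpha><Suc l. (\<Prod>\<beta>=0..<Suc l. N \<alpha> $$ (\<beta>, p \<beta>)) * ?e \<alpha>))"
    by (subst nc_det_apply) (simp_all add: weyl_fun_in_carrier weyl_gen_in_carrier prod del: upt_Suc prod.op_ivl_Suc sum.lessThan_Suc)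
  also have "\<dots> = (\<Sum>\<alpha><Suc l. \<Sum>p | p permutes {0..<Suc l}. of_int (sign p) *
      (\<Prod>\<beta>=0..<Suc l. N \<alpha> $$ (\<beta>, p \<beta>)) * ?e \<alpha>)"
    by (subst sum.swap) (simp add: sum_distrib_left mult.assoc del: prod.op_ivl_Suc sum.lessThan_Suc)
  also have "\<dots> = (\<Sum>\<alpha><Suc l. det (N \<alpha>) * ?e \<alpha>)"
    by (subst det_def'[of _ "Suc l"]) (auto simp: N_def sum_distrib_right simp del: prod.op_ivl_Suc sum.lessThan_Suc)
  also have "\<dots> = (\<Oplus>\<^bsub>?W\<^esub>\<alpha>\<in>{..<Suc l}.
      weyl_fun ((-1) ^ (\<alpha> + l) * det (mat_delete (mat (Suc l) (Suc l) (\<lambda>(\<beta>, j). b \<beta> j)) \<alpha> l))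
      \<otimes>\<^bsub>?W\<^esub> weyl_gen (\<gamma> \<alpha>)) m"
    by (subst weyl_finsum_apply)
       (auto simp: weyl_fun_in_carrier weyl_gen_in_carrier weyl_fun_mult_apply N_def det_unit_last_column
         simp del: sum.lessThan_Suc intro!: sum.cong)
  finally show "nc_det ?W (Suc l) ?A m = (\<Oplus>\<^bsub>?W\<^esub>\<alpha>\<in>{..<Suc l}.
      weyl_fun ((-1) ^ (\<alpha> + l) * det (mat_delete (mat (Suc l) (Suc l) (\<lambda>(\<beta>, j). b \<beta> j)) \<alpha> l))
      \<otimes>\<^bsub>?W\<^esub> weyl_gen (\<gamma> \<alpha>)) m" .
qed

lemma
  fixes A :: "'a::comm_ring_1 mat"
  assumes A: "A \<in> carrier_mat n n" and "i < n" "j < n"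
  shows sum_row_mult_cofactor: "(\<Sum>k<n. A $$ (i, k) * cofactor A j k) = (if i = j then det A else 0)"
    and sum_cofactor_mult_column: "(\<Sum>k<n. cofactor A k i * A $$ (k, j)) = (if i = j then det A else 0)"
proof -
  have "(\<Sum>k<n. A $$ (i, k) * cofactor A j k) = (A * adj_mat A) $$ (i, j)"
    using assms by (auto simp: adj_mat_def scalar_prod_def lessThan_atLeast0 intro!: sum.cong)
  then show "(\<Sum>k<n. A $$ (i, k) * cofactor A j k) = (if i = j then det A else 0)"
    using assms by (simp add: adj_mat(2)[OF A])
  have "(\<Sum>k<n. cofactor A k i * A $$ (k, j)) = (adj_mat A * A) $$ (i, j)"
    using assms by (auto simp: adj_mat_def scalar_prod_def lessThan_atLeast0 intro!: sum.cong)
  then show "(\<Sum>k<n. cofactor A k i * A $$ (k, j)) = (if i = j then det A else 0)"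
    using assms by (simp add: adj_mat(3)[OF A])
qed

section \<open>The determinant of theta functions\<close>

text \<open>
  Expanding the minor of size \<open>k + 1\<close> along its last row shows that, as a function of the last
  point, it is a linear combination of the functions in which \<open>\<theta> k\<close> has the previous minor as its
  coefficient. By independence it is nonzero at some point of \<open>U k\<close>.
\<close>

lemma det_nonzero_points:
  fixes \<theta> :: "nat \<Rightarrow> 'a \<Rightarrow> 'b::comm_ring_1" and U :: "nat \<Rightarrow> 'a set"
  assumes indep: "\<And>c \<alpha>. \<alpha> < n \<Longrightarrow> (\<And>x. x \<in> U \<alpha> \<Longrightarrow> (\<Sum>j<n. c j * \<theta> j x) = 0) \<Longrightarrow>
      (\<And>j. j < n \<Longrightarrow> c j = 0)"
    and "k \<le> n"
  shows "\<exists>x. (\<forall>\<alpha><k. x \<alpha> \<in> U \<alpha>) \<and> det (mat k k (\<lambda>(\<alpha>, j). \<theta> j (x \<alpha>))) \<noteq> 0"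
  using \<open>k \<le> n\<close>
proof (induction k)
  case 0
  have "det (mat 0 0 (\<lambda>(\<alpha>, j). \<theta> j (x \<alpha>))) = 1" for x :: "nat \<Rightarrow> 'a"
    by (simp add: det_def)
  then show ?case by simp
next
  case (Suc k)
  then obtain x where x: "\<forall>\<alpha><k. x \<alpha> \<in> U \<alpha>" "det (mat k k (\<lambda>(\<alpha>, j). \<theta> j (x \<alpha>))) \<noteq> 0"
    by auto
  let ?M = "\<lambda>y. mat (Suc k) (Suc k) (\<lambda>(\<alpha>, j). \<theta> j ((x(k := y)) \<alpha>))"
  define c where "c j = (if j \<le> k then (-1) ^ (k + j) * det (mat k k (\<lambda>(\<alpha>, j').
      \<theta> (if j' < j then j' else Suc j') (x \<alpha>))) else 0)" for j
  have expand: "det (?M y) = (\<Sum>j<n. c j * \<theta> j y)" for y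
  proof -
    have "det (?M y) = (\<Sum>j<Suc k. ?M y $$ (k, j) * cofactor (?M y) k j)"
      by (rule laplace_expansion_row) auto
    also have "\<dots> = (\<Sum>j<Suc k. c j * \<theta> j y)"
    proof (rule sum.cong[OF refl])
      fix j assume j: "j \<in> {..<Suc k}"
      have "mat_delete (?M y) k j = mat k k (\<lambda>(\<alpha>, j'). \<theta> (if j' < j then j' else Suc j') (x \<alpha>))"
        using j by (intro eq_matI) (auto simp: mat_delete_def)
      then show "?M y $$ (k, j) * cofactor (?M y) k j = c j * \<theta> j y"
        using j by (simp add: cofactor_def c_def mult.commute)
    qed
    also have "\<dots> = (\<Sum>j<n. c j * \<theta> j y)"
      using Suc.prems by (intro sum.mono_neutral_left) (auto simp: c_def)
    finally show ?thesis .
  qed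
  have "mat k k (\<lambda>(\<alpha>, j'). \<theta> (if j' < k then j' else Suc j') (x \<alpha>)) = mat k k (\<lambda>(\<alpha>, j). \<theta> j (x \<alpha>))"
    by (rule eq_matI) auto
  then have "c k \<noteq> 0"
    using x(2) by (simp add: c_def)
  then obtain y where y: "y \<in> U k" "(\<Sum>j<n. c j * \<theta> j y) \<noteq> 0"
    using indep[of k c k] Suc.prems by (metis Suc_le_lessD)
  have "\<forall>\<alpha><Suc k. (x(k := y)) \<alpha> \<in> U \<alpha>"
    using x(1) y(1) by (simp add: less_Suc_eq)
  moreover have "det (?M y) \<noteq> 0"
    using y(2) by (simp only: expand not_False_eq_True)
  ultimately show ?case by blast
qed

lemma theta_basis_holomorphic:
  assumes "Theta_basis n \<tau> \<theta>" "j < n"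
  shows "\<theta> j holomorphic_on UNIV"
proof -
  have "\<theta> j \<in> cfun.span (\<theta> ` {..<n})"
    using assms(2) by (intro cfun.span_base) auto
  then show ?thesis
    using assms(1) by (simp add: Theta_basis_def Theta_def)
qed

lemma sum_fun_apply: "(\<Sum>a\<in>A. f a) x = (\<Sum>a\<in>A. f a x :: 'b::comm_monoid_add)"
  by (induction A rule: infinite_finite_induct) auto

text \<open>
  By the identity theorem a linear relation that holds on \<open>U\<close> holds on the whole plane.
\<close>

lemma theta_basis_independent_on_open:
  assumes basis: "Theta_basis n \<tau> \<theta>" and U: "open U" "U \<noteq> {}"
    and zero: "\<And>x. x \<in> U \<Longrightarrow> (\<Sum>j<n. c j * \<theta> j x) = 0" and j: "j < n"
  shows "c j = 0"
proof -
  have all: "(\<Sum>j<n. c j * \<theta> j z) = 0" for z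
    by (rule analytic_continuation_open[where f = "\<lambda>z. \<Sum>j<n. c j * \<theta> j z" and g = "\<lambda>_. 0", OF U(1) open_UNIV U(2)])
       (auto intro!: holomorphic_intros theta_basis_holomorphic[OF basis] zero)
  have inj: "inj_on \<theta> {..<n}"
    using basis by (simp add: Theta_basis_def)
  let ?u = "\<lambda>v. c (the_inv_into {..<n} \<theta> v)"
  have "(\<Sum>v\<in>\<theta> ` {..<n}. (\<lambda>z. ?u v * v z)) = (0 :: complex \<Rightarrow> complex)"
  proof
    fix z
    have "(\<Sum>v\<in>\<theta> ` {..<n}. (\<lambda>z. ?u v * v z)) z = (\<Sum>v\<in>\<theta> ` {..<n}. ?u v * v z)"
      by (rule sum_fun_apply)
    also have "\<dots> = (\<Sum>j<n. c j * \<theta> j z)"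
      using inj by (subst sum.reindex) (auto intro!: sum.cong simp: the_inv_into_f_f)
    finally show "(\<Sum>v\<in>\<theta> ` {..<n}. (\<lambda>z. ?u v * v z)) z = 0 z"
      using all by simp
  qed
  moreover have "\<forall>u. (\<Sum>v\<in>\<theta> ` {..<n}. (\<lambda>z. u v * v z)) = 0 \<longrightarrow> (\<forall>v\<in>\<theta> ` {..<n}. u v = 0)"
    using basis unfolding Theta_basis_def cfun.independent_explicit_finite_subsets by blast
  ultimately have "\<forall>v\<in>\<theta> ` {..<n}. ?u v = 0"
    by (elim allE[of _ ?u] impE)
  then have "?u (\<theta> j) = 0"
    using j by blast
  then show ?thesis
    using inj j by (simp add: the_inv_into_f_f)
qed

text \<open>
  A nonempty open set contains a product of open subsets of the plane, and the determinant can be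
  made nonzero by choosing its points factor by factor.
\<close>

lemma theta_det_nonzero_on_open:
  fixes W :: "(complex ^ 'n::finite) set"
  assumes basis: "Theta_basis CARD('n) \<tau> \<theta>" and W: "open W" "W \<noteq> {}"
  shows "\<exists>z\<in>W. det (mat CARD('n) CARD('n) (\<lambda>(\<alpha>, j). \<theta> j (vec_nth z (coord \<alpha>)))) \<noteq> 0"
proof -
  let ?n = "CARD('n)"
  obtain z0 where z0: "z0 \<in> W" using W by auto
  obtain A where A: "\<forall>i. open (A i) \<and> vec_nth z0 i \<in> A i"
    and AW: "\<forall>y. (\<forall>i. vec_nth y i \<in> A i) \<longrightarrow> y \<in> W"
    using bspec[OF W(1)[unfolded open_vec_def] z0] by blast
  have "\<exists>x. (\<forall>\<alpha><?n. x \<alpha> \<in> A (coord \<alpha>)) \<and> det (mat ?n ?n (\<lambda>(\<alpha>, j). \<theta> j (x \<alpha>))) \<noteq> 0"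
  proof (rule det_nonzero_points[where n = ?n and U = "\<lambda>\<alpha>. A (coord \<alpha>)" and \<theta> = \<theta>])
    fix c \<alpha> j
    assume "\<And>x. x \<in> A (coord \<alpha>) \<Longrightarrow> (\<Sum>j<?n. c j * \<theta> j x) = 0" "j < ?n"
    then show "c j = 0"
      using A by (intro theta_basis_independent_on_open[where c = c and j = j, OF basis, of "A (coord \<alpha>)"]) auto
  qed simp
  then obtain x where x: "\<forall>\<alpha><?n. x \<alpha> \<in> A (coord \<alpha>)"
    and det: "det (mat ?n ?n (\<lambda>(\<alpha>, j). \<theta> j (x \<alpha>))) \<noteq> 0"
    by blast
  define idx where "idx = the_inv_into {..<?n} (coord :: nat \<Rightarrow> 'n)"
  note bij = bij_betw_coord[where 'n = 'n]
  have idx: "idx (coord \<alpha>) = \<alpha>" if "\<alpha> < ?n" for \<alpha>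
    unfolding idx_def using that bij by (intro the_inv_into_f_f) (auto simp: bij_betw_def)
  have idx_less: "idx i < ?n" "coord (idx i) = i" for i
    unfolding idx_def using bij the_inv_into_into[of coord "{..<?n}" i "{..<?n}"]
      f_the_inv_into_f_bij_betw[OF bij, of i] by (auto simp: bij_betw_def)
  let ?z = "\<chi> i. x (idx i)"
  have "vec_nth ?z i \<in> A i" for i
    using x idx_less[of i] by (metis vec_lambda_beta)
  with AW have "?z \<in> W"
    by blast
  moreover have "mat ?n ?n (\<lambda>(\<alpha>, j). \<theta> j (vec_nth ?z (coord \<alpha>))) = mat ?n ?n (\<lambda>(\<alpha>, j). \<theta> j (x \<alpha>))"
    by (rule eq_matI) (auto simp: idx)
  ultimately show ?thesis
    using det by metis
qed

section \<open>Commutativity of the ratios\<close>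

theorem proposition3p1:
  fixes \<tau> \<eta> :: complex and \<theta> :: "nat \<Rightarrow> complex \<Rightarrow> complex"
    and V :: "'n::finite weyl ring"
  assumes "CARD('n) \<ge> 2" and "Im \<tau> > 0"
    and "Theta_basis CARD('n) \<tau> \<theta>"
    and "V = weyl_algebra \<eta>"
  shows "D_zero \<eta> \<theta> \<in> Units V \<and>
    (\<forall>i\<in>{1..CARD('n)}. \<forall>j\<in>{1..CARD('n)}.
       D_ratio \<eta> \<theta> i \<otimes>\<^bsub>V\<^esub> D_ratio \<eta> \<theta> j \<ominus>\<^bsub>V\<^esub> D_ratio \<eta> \<theta> j \<otimes>\<^bsub>V\<^esub> D_ratio \<eta> \<theta> i = \<zero>\<^bsub>V\<^esub>)"
proof -
  note basis = assms(3)
  note V = assms(4)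
  interpret ring V
    unfolding V by (rule ring_weyl_algebra)
  obtain l where card: "CARD('n) = Suc l"
    using assms(1) by (cases "CARD('n)") auto
  define n where "n = Suc l"
  have n: "CARD('n) = n" "n = Suc l"
    by (simp_all add: card n_def)
  define b where "b \<alpha> j = mero_of (\<lambda>z::complex ^ 'n. \<theta> j (vec_nth z (coord \<alpha>)))" for \<alpha> j
  define f where "f \<alpha> = (weyl_gen (coord \<alpha>) :: 'n weyl)" for \<alpha>
  define M where "M = mat n n (\<lambda>(\<alpha>, j). b \<alpha> j)"
  have M: "M \<in> carrier_mat n n"
    by (simp add: M_def)
  have weyl_fun_closed: "weyl_fun F \<in> carrier V" for F
    by (simp add: V weyl_fun_in_carrier)
  have f_closed: "f \<alpha> \<in> carrier V" for \<alpha>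
    by (simp add: f_def V weyl_gen_in_carrier)

  have hol: "holomorphic_cn (\<lambda>z::complex ^ 'n. \<theta> j (vec_nth z (coord \<alpha>))) UNIV" if "j < n" for \<alpha> j
    using theta_basis_holomorphic[OF basis] that by (intro holomorphic_cn_coordinate) (simp add: n)
  have "det M = mero_of (\<lambda>z. det (mat n n (\<lambda>(\<alpha>, j). \<theta> j (vec_nth z (coord \<alpha>)))))"
    unfolding M_def b_def by (intro mero_of_det hol)
  moreover have "\<exists>u. mero_of (\<lambda>z::complex ^ 'n. det (mat n n (\<lambda>(\<alpha>, j). \<theta> j (vec_nth z (coord \<alpha>))))) * u = 1"
  proof (rule mero_of_invertible)
    show "holomorphic_cn (\<lambda>z::complex ^ 'n. det (mat n n (\<lambda>(\<alpha>, j). \<theta> j (vec_nth z (coord \<alpha>))))) UNIV"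
      by (intro holomorphic_cn_det hol)
    show "\<exists>z\<in>W. det (mat n n (\<lambda>(\<alpha>, j). \<theta> j (vec_nth z (coord \<alpha>)))) \<noteq> 0"
      if "open W" "W \<noteq> {}" for W :: "(complex ^ 'n) set"
      using theta_det_nonzero_on_open[OF basis that] unfolding n(1) .
  qed
  ultimately obtain u where u: "det M * u = 1"
    by auto
  have D_zero: "D_zero \<eta> \<theta> = weyl_fun (det M)"
    unfolding D_zero_def theta_at_def[abs_def] b_def[symmetric] n(1) M_def by (rule nc_det_weyl_fun)
  have inverse: "weyl_fun (det M) \<otimes>\<^bsub>V\<^esub> weyl_fun u = \<one>\<^bsub>V\<^esub>" "weyl_fun u \<otimes>\<^bsub>V\<^esub> weyl_fun (det M) = \<one>\<^bsub>V\<^esub>"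
    using u by (simp_all add: V weyl_fun_mult weyl_fun_one mult.commute)
  then have unit: "D_zero \<eta> \<theta> \<in> Units V"
    unfolding D_zero Units_def using weyl_fun_closed by blast
  have inv: "inv\<^bsub>V\<^esub> (D_zero \<eta> \<theta>) = weyl_fun u"
    unfolding D_zero using inverse weyl_fun_closed by (metis inv_unique')

  have fb: "f \<alpha> \<otimes>\<^bsub>V\<^esub> weyl_fun (b \<beta> j) = weyl_fun (b \<beta> j) \<otimes>\<^bsub>V\<^esub> f \<alpha>"
    if "\<alpha> < n" "\<beta> < n" "\<alpha> \<noteq> \<beta>" "j < n" for \<alpha> \<beta> j
  proof -
    have "coord \<alpha> \<noteq> (coord \<beta> :: 'n)"
      using that bij_betw_coord[where 'n = 'n] n(1) by (auto simp: bij_betw_def inj_on_def)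
    then show ?thesis
      unfolding f_def b_def V using theta_basis_holomorphic[OF basis, of j] that n(1)
      by (intro weyl_gen_commute_other_coordinate) auto
  qed

  \<comment> \<open>\<open>C\<close> consists of the coefficients of the \<open>f \<alpha>\<close> in the ratios. They differ from the entries
    \<open>(-1) ^ (\<alpha> + i) * det (mat_delete M \<alpha> i) * u\<close> of the inverse of \<open>M\<close> by the sign
    \<open>(-1) ^ (i + l)\<close>, coming from column \<open>i\<close> having been replaced by a column in the last place.
    Hence \<open>C\<close> inverts the matrix \<open>B\<close> obtained from \<open>M\<close> by giving column \<open>i\<close> the same sign.\<close>
  define C where "C i \<alpha> = (weyl_fun (u * ((-1) ^ (\<alpha> + l) * det (mat_delete M \<alpha> i))) :: 'n weyl)" for i \<alpha>
  define B where "B \<alpha> i = (weyl_fun ((-1) ^ (i + l) * b \<alpha> i) :: 'n weyl)" for \<alpha> i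
  \<comment> \<open>The ratios are numbered from 1 and the columns of \<open>M\<close> from 0.\<close>
  have ratio: "D_ratio \<eta> \<theta> (Suc i) = (\<Oplus>\<^bsub>V\<^esub>\<alpha>\<in>{..<n}. C i \<alpha> \<otimes>\<^bsub>V\<^esub> f \<alpha>)" if i: "i < n" for i
  proof -
    let ?b = "\<lambda>\<alpha> j. b \<alpha> (if Suc j < Suc i then j else Suc j)"
    have "D_del \<eta> \<theta> (Suc i) = nc_det V n (\<lambda>\<alpha> j. if j = l then f \<alpha> else weyl_fun (?b \<alpha> j))"
      unfolding D_del_def theta_at_def b_def f_def V card n(2) by simp
    also have "\<dots> = (\<Oplus>\<^bsub>V\<^esub>\<alpha>\<in>{..<n}. weyl_fun ((-1) ^ (\<alpha> + l) *
        det (mat_delete (mat n n (\<lambda>(\<beta>, j). ?b \<beta> j)) \<alpha> l)) \<otimes>\<^bsub>V\<^esub> f \<alpha>)"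
      unfolding f_def V n(2) using fb unfolding f_def V n(2)
      by (intro nc_det_generator_column) auto
    also have "\<dots> = (\<Oplus>\<^bsub>V\<^esub>\<alpha>\<in>{..<n}. weyl_fun ((-1) ^ (\<alpha> + l) * det (mat_delete M \<alpha> i)) \<otimes>\<^bsub>V\<^esub> f \<alpha>)"
    proof (rule finsum_cong')
      fix \<alpha> assume "\<alpha> \<in> {..<n}"
      then have "mat_delete (mat n n (\<lambda>(\<beta>, j). ?b \<beta> j)) \<alpha> l = mat_delete M \<alpha> i"
        using i by (intro eq_matI) (auto simp: mat_delete_def M_def n(2))
      then show "weyl_fun ((-1) ^ (\<alpha> + l) * det (mat_delete (mat n n (\<lambda>(\<beta>, j). ?b \<beta> j)) \<alpha> l)) \<otimes>\<^bsub>V\<^esub> f \<alpha> =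
          weyl_fun ((-1) ^ (\<alpha> + l) * det (mat_delete M \<alpha> i)) \<otimes>\<^bsub>V\<^esub> f \<alpha>"
        by simp
    qed (use weyl_fun_closed f_closed in auto)
    finally have "D_ratio \<eta> \<theta> (Suc i) = weyl_fun u \<otimes>\<^bsub>V\<^esub>
        (\<Oplus>\<^bsub>V\<^esub>\<alpha>\<in>{..<n}. weyl_fun ((-1) ^ (\<alpha> + l) * det (mat_delete M \<alpha> i)) \<otimes>\<^bsub>V\<^esub> f \<alpha>)"
      using inv by (simp add: D_ratio_def V)
    also have "\<dots> = (\<Oplus>\<^bsub>V\<^esub>\<alpha>\<in>{..<n}. weyl_fun u \<otimes>\<^bsub>V\<^esub>
        (weyl_fun ((-1) ^ (\<alpha> + l) * det (mat_delete M \<alpha> i)) \<otimes>\<^bsub>V\<^esub> f \<alpha>))"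
      using weyl_fun_closed f_closed by (intro finsum_rdistr) auto
    also have "\<dots> = (\<Oplus>\<^bsub>V\<^esub>\<alpha>\<in>{..<n}. C i \<alpha> \<otimes>\<^bsub>V\<^esub> f \<alpha>)"
    proof (rule finsum_cong')
      fix \<alpha>
      show "weyl_fun u \<otimes>\<^bsub>V\<^esub> (weyl_fun ((-1) ^ (\<alpha> + l) * det (mat_delete M \<alpha> i)) \<otimes>\<^bsub>V\<^esub> f \<alpha>) =
          C i \<alpha> \<otimes>\<^bsub>V\<^esub> f \<alpha>"
        unfolding C_def using weyl_fun_closed f_closed by (simp add: V weyl_fun_mult flip: weyl_mult_assoc)
    qed (use weyl_fun_closed f_closed in \<open>auto simp: C_def\<close>)
    finally show ?thesis .
  qed

  have BC: "(\<Oplus>\<^bsub>V\<^esub>i\<in>{..<n}. B \<alpha> i \<otimes>\<^bsub>V\<^esub> C i \<beta>) = (if \<alpha> = \<beta> then \<one>\<^bsub>V\<^esub> else \<zero>\<^bsub>V\<^esub>)"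
    if "\<alpha> \<in> {..<n}" "\<beta> \<in> {..<n}" for \<alpha> \<beta>
  proof -
    have sign: "(-1) ^ (i + l) * (-1) ^ (\<beta> + l) = ((-1) ^ (\<beta> + i) :: 'n mero)" for i
      by (auto simp: minus_one_power_iff)
    have "B \<alpha> i \<otimes>\<^bsub>V\<^esub> C i \<beta> = weyl_fun (u * (M $$ (\<alpha>, i) * cofactor M \<beta> i))" if "i < n" for i
    proof -
      have "(-1) ^ (i + l) * b \<alpha> i * (u * ((-1) ^ (\<beta> + l) * det (mat_delete M \<beta> i))) =
          u * (b \<alpha> i * (((-1) ^ (i + l) * (-1) ^ (\<beta> + l)) * det (mat_delete M \<beta> i)))"
        by (simp only: ac_simps)
      also have "\<dots> = u * (M $$ (\<alpha>, i) * cofactor M \<beta> i)"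
        using \<open>\<alpha> \<in> {..<n}\<close> that unfolding sign cofactor_def by (simp add: M_def)
      finally show ?thesis
        by (simp only: B_def C_def V weyl_fun_mult)
    qed
    then have "(\<Oplus>\<^bsub>V\<^esub>i\<in>{..<n}. B \<alpha> i \<otimes>\<^bsub>V\<^esub> C i \<beta>) =
        (\<Oplus>\<^bsub>V\<^esub>i\<in>{..<n}. weyl_fun (u * (M $$ (\<alpha>, i) * cofactor M \<beta> i)))"
      using weyl_fun_closed by (intro finsum_cong') auto
    also have "\<dots> = weyl_fun (u * (\<Sum>i<n. M $$ (\<alpha>, i) * cofactor M \<beta> i))"
      by (simp only: V weyl_fun_finsum sum_distrib_left)
    finally show ?thesis
      using that u sum_row_mult_cofactor[OF M, of \<alpha> \<beta>]
      by (simp add: V weyl_fun_one weyl_fun_zero mult.commute)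
  qed
  have CB: "(\<Oplus>\<^bsub>V\<^esub>\<alpha>\<in>{..<n}. C i \<alpha> \<otimes>\<^bsub>V\<^esub> B \<alpha> j) = (if i = j then \<one>\<^bsub>V\<^esub> else \<zero>\<^bsub>V\<^esub>)"
    if "i \<in> {..<n}" "j \<in> {..<n}" for i j
  proof -
    let ?s = "(-1) ^ (i + l) * (-1) ^ (j + l) :: 'n mero"
    have sign: "(-1) ^ (\<alpha> + l) = ((-1) ^ (i + l) * (-1) ^ (\<alpha> + i) :: 'n mero)" for \<alpha>
      by (auto simp: minus_one_power_iff)
    have "C i \<alpha> \<otimes>\<^bsub>V\<^esub> B \<alpha> j = weyl_fun (u * ?s * (cofactor M \<alpha> i * M $$ (\<alpha>, j)))" if "\<alpha> < n" for \<alpha>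
    proof -
      have "u * ((-1) ^ (\<alpha> + l) * det (mat_delete M \<alpha> i)) * ((-1) ^ (j + l) * b \<alpha> j) =
          u * ?s * (((-1) ^ (\<alpha> + i) * det (mat_delete M \<alpha> i)) * b \<alpha> j)"
        unfolding sign[of \<alpha>] by (simp only: ac_simps)
      also have "\<dots> = u * ?s * (cofactor M \<alpha> i * M $$ (\<alpha>, j))"
        using \<open>j \<in> {..<n}\<close> that unfolding cofactor_def by (simp add: M_def)
      finally show ?thesis
        by (simp only: B_def C_def V weyl_fun_mult)
    qed
    then have "(\<Oplus>\<^bsub>V\<^esub>\<alpha>\<in>{..<n}. C i \<alpha> \<otimes>\<^bsub>V\<^esub> B \<alpha> j) =
        (\<Oplus>\<^bsub>V\<^esub>\<alpha>\<in>{..<n}. weyl_fun (u * ?s * (cofactor M \<alpha> i * M $$ (\<alpha>, j))))"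
      using weyl_fun_closed by (intro finsum_cong') auto
    also have "\<dots> = weyl_fun (u * ?s * (\<Sum>\<alpha><n. cofactor M \<alpha> i * M $$ (\<alpha>, j)))"
      by (simp only: V weyl_fun_finsum sum_distrib_left)
    also have "(\<Sum>\<alpha><n. cofactor M \<alpha> i * M $$ (\<alpha>, j)) = (if i = j then det M else 0)"
      using that by (intro sum_cofactor_mult_column[OF M]) auto
    also have "u * ?s * (if i = j then det M else 0) = (if i = j then 1 else 0)"
      using u by (auto simp: mult.commute minus_one_power_iff)
    finally show ?thesis
      by (simp add: V weyl_fun_one weyl_fun_zero)
  qed
  have commute: "D_ratio \<eta> \<theta> (Suc i) \<otimes>\<^bsub>V\<^esub> D_ratio \<eta> \<theta> (Suc j) = D_ratio \<eta> \<theta> (Suc j) \<otimes>\<^bsub>V\<^esub> D_ratio \<eta> \<theta> (Suc i)"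
    if "i < n" "j < n" for i j
    unfolding ratio[OF that(1)] ratio[OF that(2)]
  proof (rule separated_system_solutions_commute[where B = B and I = "{..<n}", OF _ _ _ _ _ BC CB])
    show "f \<alpha> \<otimes>\<^bsub>V\<^esub> f \<beta> = f \<beta> \<otimes>\<^bsub>V\<^esub> f \<alpha>" for \<alpha> \<beta>
      by (simp add: f_def V weyl_gen_commute)
    show "B \<alpha> i \<otimes>\<^bsub>V\<^esub> B \<beta> j = B \<beta> j \<otimes>\<^bsub>V\<^esub> B \<alpha> i" for \<alpha> \<beta> i j
      by (simp add: B_def V weyl_fun_mult mult.commute)
    show "f \<alpha> \<otimes>\<^bsub>V\<^esub> B \<beta> i = B \<beta> i \<otimes>\<^bsub>V\<^esub> f \<alpha>"
      if "\<alpha> \<in> {..<n}" "\<beta> \<in> {..<n}" "\<alpha> \<noteq> \<beta>" "i \<in> {..<n}" for \<alpha> \<beta> i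
    proof (cases "even (i + l)")
      case True
      then show ?thesis
        using that fb[of \<alpha> \<beta> i] by (simp add: B_def)
    next
      case False
      then have "B \<beta> i = \<ominus>\<^bsub>V\<^esub> weyl_fun (b \<beta> i)"
        by (simp add: B_def V weyl_fun_uminus)
      then show ?thesis
        using that fb[of \<alpha> \<beta> i] weyl_fun_closed f_closed by (simp add: r_minus l_minus)
    qed
  qed (use that weyl_fun_closed f_closed in \<open>auto simp: B_def C_def\<close>)
  have closed: "D_ratio \<eta> \<theta> (Suc i) \<in> carrier V" if "i < n" for i
    unfolding ratio[OF that] using weyl_fun_closed f_closed by (intro finsum_closed) (auto simp: C_def)
  show ?thesis
  proof (intro conjI ballI unit)
    fix i j assume "i \<in> {1..CARD('n)}" "j \<in> {1..CARD('n)}"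
    then obtain i' j' where "i = Suc i'" "j = Suc j'" "i' < n" "j' < n"
      using n(1) by (cases i; cases j) auto
    then show "D_ratio \<eta> \<theta> i \<otimes>\<^bsub>V\<^esub> D_ratio \<eta> \<theta> j \<ominus>\<^bsub>V\<^esub> D_ratio \<eta> \<theta> j \<otimes>\<^bsub>V\<^esub> D_ratio \<eta> \<theta> i = \<zero>\<^bsub>V\<^esub>"
      using commute[of i' j'] closed[of i'] closed[of j'] by (simp add: minus_eq r_neg)
  qed
qed

end
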